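(* Let $d\ge1$ be an integer and $0<\theta<1$ a real number with $d\theta>1$. If $k_1,k_2\ge1$ are integers with $k_1\ne k_2$, then $T(\mathcal A_d^{k_1},\theta)$ is not isomorphic to $T(\mathcal A_d^{k_2},\theta)$.
   Context: Sequences and orders. $\omega=\{0,1,2,\dots\}$. For an integer $k\ge1$, $\omega^{\not\downarrow\le k}$ is the set of all non-decreasing finite sequences of elements of $\omega$ of length at most $k$ (including the empty sequence $()$), and $\omega^{\not\downarrow k}$ is the set of those of length exactly $k$. Write $s\sqsubset t$ if $s$ is a proper initial segment of $t$. Let $<_{\mathrm{lex}}$ be the lexicographic order in which a proper initial segment precedes the longer sequence. The well-order $\prec$ (of order type $\omega$) on $\omega^{\not\downarrow\le k}$ is: $()\prec s$ for all nonempty $s$; and for nonempty sequences, $(s_1,\dots,s_i)\prec(t_1,\dots,t_j)$ iff $s_i<t_j$, or $s_i=t_j$ and $(s_1,\dots,s_i)<_{\mathrm{lex}}(t_1,\dots,t_j)$. The spaces $\mathcal E_k$. An $\mathcal E_k$-tree is a function $\widehat X:\omega^{\not\downarrow\le k}\to\omega^{\not\downarrow\le k}$ preserving $\prec$ and $\sqsubset$ (hence preserving lengths). $\mathcal E_k$ is the collection of all sets $X=\widehat X[\omega^{\not\downarrow k}]$, for $\widehat X$ an $\mathcal E_k$-tree. For $X\in\mathcal E_k$ and $n\ge1$, $r_n(X)$ is the set of the $\prec$-least $n$ elements of $X$; $\mathcal{AR}^k_n=\{r_n(X):X\in\mathcal E_k\}$, $\mathcal{AR}^k=\bigcup_{n\ge1}\mathcal{AR}^k_n$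 and $\mathcal A_d^k=\bigcup_{i=1}^d\mathcal{AR}_i^k$. (For $k=1$, $\mathcal{AR}^1$ is the set of all nonempty finite subsets of $\omega$.) The Banach space $T(\mathcal A_d^k,\theta)$. For nonempty finite $E,F\subset\omega^{\not\downarrow k}$, $E<F$ (resp. $E\le F$) means $\max_\prec E\prec\min_\prec F$ (resp. $\preceq$); an element $v$ is treated as $\{v\}$. For $1\le m\le d$, a sequence $(E_i)_{i=1}^m$ in $\mathcal{AR}^k$ is $\mathcal A_d^k$-admissible if there is $\{v_1,\dots,v_m\}\in\mathcal A_d^k$ with $v_1\le E_1<v_2\le E_2<\cdots<v_m\le E_m$. On the space $c_{00}(\omega^{\not\downarrow k})$ of finitely supported functions $x:\omega^{\not\downarrow k}\to\mathbb R$, with canonical basis $(e_v)$ and $Ex=\sum_{v\in E}x_ve_v$, put $|x|_0=\max_v|x_v|$, $|x|_{j+1}=\max\{|x|_j,\ \theta\max\{\sum_{i=1}^m|E_ix|_j:1\le m\le d,\ (E_i)_{i=1}^m\ \mathcal A_d^k\text{-admissible}\}\}$, and $\|x\|=\sup_j|x|_j$. $T(\mathcal A_d^k,\theta)$ is the completion of $c_{00}(\omega^{\not\downarrow k})$ in this norm. "Isomorphic" means linearly homeomorphic. *)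

theory Defs
  imports "HOL-Analysis.Analysis" "HOL-Library.Sublist"
begin

definition ndseq_le :: "nat \<Rightarrow> nat list set" where
  "ndseq_le k = {s. sorted s \<and> length s \<le> k}"

definition ndseq :: "nat \<Rightarrow> nat list set" where
  "ndseq k = {s. sorted s \<and> length s = k}"

text \<open>\<^const>\<open>lexord\<close> puts a proper initial segment before the longer sequence.\<close>

definition seq_less :: "nat list \<Rightarrow> nat list \<Rightarrow> bool" (infix "\<lhd>" 50) where
  "s \<lhd> t \<longleftrightarrow>
     (if s = [] then t \<noteq> []
      else t \<noteq> [] \<and> (last s < last t \<or> last s = last t \<and> (s, t) \<in> lexord {(a, b). a < b}))"

definition E_tree :: "nat \<Rightarrow> (nat list \<Rightarrow> nat list) \<Rightarrow> bool" where
  "E_tree k X \<longleftrightarrow>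
     X \<in> ndseq_le k \<rightarrow> ndseq_le k \<and>
     (\<forall>s\<in>ndseq_le k. \<forall>t\<in>ndseq_le k. s \<lhd> t \<longrightarrow> X s \<lhd> X t) \<and>
     (\<forall>s\<in>ndseq_le k. \<forall>t\<in>ndseq_le k. strict_prefix s t \<longrightarrow> strict_prefix (X s) (X t))"

definition E_space :: "nat \<Rightarrow> nat list set set" where
  "E_space k = {X ` ndseq k | X. E_tree k X}"

text \<open>The \<open>n\<close> least elements of \<open>X\<close> are those with fewer than \<open>n\<close> predecessors in \<open>X\<close>;
  on \<^term>\<open>ndseq k\<close> every element has only finitely many predecessors.\<close>

definition approx :: "nat \<Rightarrow> nat list set \<Rightarrow> nat list set" where
  "approx n X = {x \<in> X. card {y \<in> X. y \<lhd> x} < n}"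

definition AR_n :: "nat \<Rightarrow> nat \<Rightarrow> nat list set set" where
  "AR_n k n = {approx n X | X. X \<in> E_space k}"

definition AR :: "nat \<Rightarrow> nat list set set" where
  "AR k = (\<Union>n\<in>{1..}. AR_n k n)"

definition A_fam :: "nat \<Rightarrow> nat \<Rightarrow> nat list set set" where
  "A_fam k d = (\<Union>i\<in>{1..d}. AR_n k i)"

text \<open>For nonempty finite sets the next two relations say \<open>max E \<lhd> min F\<close>
  and \<open>max E \<unlhd> min F\<close>.\<close>

definition block_less :: "nat list set \<Rightarrow> nat list set \<Rightarrow> bool" where
  "block_less E F \<longleftrightarrow> (\<forall>x\<in>E. \<forall>y\<in>F. x \<lhd> y)"

definition block_le :: "nat list set \<Rightarrow> nat list set \<Rightarrow> bool" where
  "block_le E F \<longleftrightarrow> (\<forall>x\<in>E. \<forall>y\<in>F. x \<lhd> y \<or> x = y)"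

definition admissible :: "nat \<Rightarrow> nat \<Rightarrow> nat list set list \<Rightarrow> bool" where
  "admissible k d Es \<longleftrightarrow>
     1 \<le> length Es \<and> length Es \<le> d \<and> set Es \<subseteq> AR k \<and>
     (\<exists>vs. length vs = length Es \<and> set vs \<in> A_fam k d \<and>
        (\<forall>i<length Es. block_le {vs ! i} (Es ! i)) \<and>
        (\<forall>i. Suc i < length Es \<longrightarrow> block_less (Es ! i) {vs ! Suc i}))"

text \<open>Vectors on \<^term>\<open>ndseq k\<close> are functions on all lists that vanish off \<^term>\<open>ndseq k\<close>.\<close>

definition c00 :: "nat \<Rightarrow> (nat list \<Rightarrow> real) set" where
  "c00 k = {x. finite {v. x v \<noteq> 0} \<and> {v. x v \<noteq> 0} \<subseteq> ndseq k}"

definition restr :: "'i set \<Rightarrow> ('i \<Rightarrow> real) \<Rightarrow> 'i \<Rightarrow> real" where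
  "restr E x = (\<lambda>v. if v \<in> E then x v else 0)"

text \<open>For \<open>x \<in> c00 k\<close> and \<open>d \<ge> 1\<close> the maxima below are over nonempty finite sets of reals:
  \<open>restr E x\<close> depends only on the trace of \<open>E\<close> on the finite support of \<open>x\<close>.\<close>

primrec pre_norm :: "nat \<Rightarrow> nat \<Rightarrow> real \<Rightarrow> nat \<Rightarrow> (nat list \<Rightarrow> real) \<Rightarrow> real" where
  "pre_norm k d \<theta> 0 = (\<lambda>x. Max ((\<lambda>v. \<bar>x v\<bar>) ` ndseq k))"
| "pre_norm k d \<theta> (Suc j) = (\<lambda>x. max (pre_norm k d \<theta> j x)
     (\<theta> * Max {(\<Sum>i<length Es. pre_norm k d \<theta> j (restr (Es ! i) x)) | Es. admissible k d Es}))"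

definition T_norm :: "nat \<Rightarrow> nat \<Rightarrow> real \<Rightarrow> (nat list \<Rightarrow> real) \<Rightarrow> real" where
  "T_norm k d \<theta> x = (SUP j. pre_norm k d \<theta> j x)"

text \<open>The completion depends on the numbers \<open>k\<close>, \<open>d\<close>, \<open>\<theta>\<close>, so it cannot be a type of class
  \<^class>\<open>banach\<close>; normed spaces are given by an explicit carrier and operations on it.\<close>

record 'a nspace =
  car :: "'a set"
  add :: "'a \<Rightarrow> 'a \<Rightarrow> 'a"
  scale :: "real \<Rightarrow> 'a \<Rightarrow> 'a"
  nrm :: "'a \<Rightarrow> real"

text \<open>The distance is set to 0 off the carrier because \<^locale>\<open>Metric_space\<close> demands symmetry
  and nonnegativity everywhere.\<close>

definition ntop :: "'a nspace \<Rightarrow> 'a topology" where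
  "ntop S = Metric_space.mtopology (car S)
     (\<lambda>x y. if x \<in> car S \<and> y \<in> car S then nrm S (add S x (scale S (-1) y)) else 0)"

definition isomorphic :: "'a nspace \<Rightarrow> 'b nspace \<Rightarrow> bool" where
  "isomorphic S S' \<longleftrightarrow>
     (\<exists>\<Phi>. (\<forall>x\<in>car S. \<forall>y\<in>car S. \<Phi> (add S x y) = add S' (\<Phi> x) (\<Phi> y)) \<and>
          (\<forall>c. \<forall>x\<in>car S. \<Phi> (scale S c x) = scale S' c (\<Phi> x)) \<and>
          homeomorphic_map (ntop S) (ntop S') \<Phi>)"

text \<open>The completion of a space \<open>V\<close> of real functions in a norm \<open>p\<close>: Cauchy sequences in \<open>V\<close>
  modulo sequences converging to 0 in norm.\<close>

definition cauchy_seqs ::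
    "('i \<Rightarrow> real) set \<Rightarrow> (('i \<Rightarrow> real) \<Rightarrow> real) \<Rightarrow> (nat \<Rightarrow> 'i \<Rightarrow> real) set" where
  "cauchy_seqs V p = {s. range s \<subseteq> V \<and>
     (\<forall>e>0. \<exists>N. \<forall>m\<ge>N. \<forall>n\<ge>N. p (\<lambda>v. s m v - s n v) < e)}"

definition null_rel ::
    "('i \<Rightarrow> real) set \<Rightarrow> (('i \<Rightarrow> real) \<Rightarrow> real) \<Rightarrow> (nat \<Rightarrow> 'i \<Rightarrow> real) rel" where
  "null_rel V p = {(s, t). s \<in> cauchy_seqs V p \<and> t \<in> cauchy_seqs V p \<and>
     (\<lambda>n. p (\<lambda>v. s n v - t n v)) \<longlonglongrightarrow> 0}"

definition completion ::
    "('i \<Rightarrow> real) set \<Rightarrow> (('i \<Rightarrow> real) \<Rightarrow> real) \<Rightarrow> (nat \<Rightarrow> 'i \<Rightarrow> real) set nspace" where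
  "completion V p =
    \<lparr>car = cauchy_seqs V p // null_rel V p,
     add = (\<lambda>A B. \<Union>s\<in>A. \<Union>t\<in>B. null_rel V p `` {\<lambda>n v. s n v + t n v}),
     scale = (\<lambda>c A. \<Union>s\<in>A. null_rel V p `` {\<lambda>n v. c * s n v}),
     nrm = (\<lambda>A. THE r. \<exists>s\<in>A. (\<lambda>n. p (s n)) \<longlonglongrightarrow> r)\<rparr>"

definition T_space :: "nat \<Rightarrow> nat \<Rightarrow> real \<Rightarrow> (nat \<Rightarrow> nat list \<Rightarrow> real) set nspace" where
  "T_space k d \<theta> = completion (c00 k) (T_norm k d \<theta>)"

end

theory Submission
  imports Defs
begin

text \<open>Let \<open>k < K\<close>. An isomorphism would, after a small perturbation, give a linear map \<open>\<Psi>\<close> from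
  \<open>c\<^sub>0\<^sub>0\<close> over \<open>ndseq K\<close> to \<open>c\<^sub>0\<^sub>0\<close> over \<open>ndseq k\<close> that is bounded and bounded below.

  Two estimates conflict. Normalized vectors that live above different children of one node and
  beyond the levels of these children span \<open>\<ell>\<^sub>\<infinity>\<^sup>n\<close> with a constant independent of \<open>n\<close>, because an
  approximation that starts late can follow only one of the children. On the other hand
  \<open>d\<^sup>r\<close> vectors of norm at least \<open>a\<close> above one node that successively move on to new children, with
  gaps between their levels, have a sum of norm at least \<open>(\<theta> d)\<^sup>r a\<close>, which is unbounded in \<open>r\<close>.

  By induction on \<open>l\<close> one shows: above a node of \<open>ndseq_le K\<close> that leaves more than \<open>l\<close> entries, some
  vector is mapped by \<open>\<Psi>\<close> essentially off any given finite set of cones over nodes of \<open>ndseq_le k\<close>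
  that leave \<open>l\<close> entries. If this failed at \<open>l + 1\<close>, the case \<open>l\<close>, applied above many children of
  the node, would give \<open>\<ell>\<^sub>\<infinity>\<close>-type vectors whose images move on to new children inside one of the
  finitely many cones. For \<open>l = k\<close> and the root this contradicts that \<open>\<Psi>\<close> is bounded below.\<close>

section \<open>Trees and approximations\<close>

abbreviation lex_less :: "(nat list \<times> nat list) set" where
  "lex_less \<equiv> lexord {(a, b). a < b}"

lemma lex_less_trans: "(s, t) \<in> lex_less \<Longrightarrow> (t, u) \<in> lex_less \<Longrightarrow> (s, u) \<in> lex_less"
  by (rule lexord_trans) (auto simp: trans_def)

lemma lex_less_irrefl: "(s, s) \<notin> lex_less"
  by (rule lexord_irreflexive) auto

lemma lex_less_linear: "(s, t) \<in> lex_less \<or> s = t \<or> (t, s) \<in> lex_less"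
  by (rule lexord_linear) auto

lemma lex_less_cases:
  assumes "(s, t) \<in> lex_less"
  obtains (prefix) "strict_prefix s t"
    | (diff) u a b s' t' where "s = u @ a # s'" "t = u @ b # t'" "a < b"
  using assms by (auto simp: lexord_def strict_prefix_def prefix_def)

lemma strict_prefix_lex_less: "strict_prefix s t \<Longrightarrow> (s, t) \<in> lex_less"
  by (auto simp: lexord_append_rightI elim!: strict_prefixE')

lemma seq_less_trans: "s \<lhd> t \<Longrightarrow> t \<lhd> u \<Longrightarrow> s \<lhd> u"
  by (auto simp: seq_less_def split: if_splits intro: lex_less_trans)

lemma seq_less_irrefl: "\<not> s \<lhd> s"
  by (auto simp: seq_less_def lex_less_irrefl)

lemma seq_less_asym: "s \<lhd> t \<Longrightarrow> \<not> t \<lhd> s"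
  using seq_less_trans seq_less_irrefl by blast

lemma seq_less_total: "s \<lhd> t \<or> s = t \<or> t \<lhd> s"
  using lex_less_linear[of s t] by (auto simp: seq_less_def)

lemma seq_less_last_le: "s \<lhd> t \<Longrightarrow> s \<noteq> [] \<Longrightarrow> last s \<le> last t"
  by (auto simp: seq_less_def)

lemma last_less_imp_seq_less: "last s < last t \<Longrightarrow> s \<noteq> [] \<Longrightarrow> t \<noteq> [] \<Longrightarrow> s \<lhd> t"
  by (auto simp: seq_less_def)

lemma sorted_le_last: "sorted s \<Longrightarrow> x \<in> set s \<Longrightarrow> x \<le> last (s :: nat list)"
  by (induction s) auto

text \<open>As \<open>t\<close> is sorted, its last entry is at least that of \<open>s\<close>; a
  tie goes to the lexicographic order, which puts initial segments first.\<close>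

lemma strict_prefix_imp_seq_less:
  assumes "strict_prefix s t" "sorted t"
  shows "s \<lhd> t"
proof -
  obtain u where u: "t = s @ u" "u \<noteq> []"
    using assms(1) by (auto simp: strict_prefix_def prefix_def)
  have "last s \<le> last t" if "s \<noteq> []"
    using that assms(2) u by (intro sorted_le_last) auto
  then show ?thesis
    using u strict_prefix_lex_less[OF assms(1)] by (auto simp: seq_less_def)
qed

lemma ndseq_subset: "ndseq k \<subseteq> ndseq_le k"
  by (auto simp: ndseq_def ndseq_le_def)

lemma ndseq_nonempty: "s \<in> ndseq k \<Longrightarrow> 1 \<le> k \<Longrightarrow> s \<noteq> []"
  by (auto simp: ndseq_def)

lemma sorted_take_nat: "sorted s \<Longrightarrow> sorted (take n (s :: nat list))"
  by (rule sorted_wrt_take)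

lemma ndseq_le_take: "s \<in> ndseq_le k \<Longrightarrow> take n s \<in> ndseq_le k"
  by (auto simp: ndseq_le_def sorted_take_nat)

lemma finite_bounded_ndseq: "finite {s \<in> ndseq_le k. set s \<subseteq> {..c}}"
  by (rule finite_subset[OF _ finite_lists_length_le[of "{..c}" k]]) (auto simp: ndseq_le_def)

lemma ndseq_le_set_last: "s \<in> ndseq_le k \<Longrightarrow> last s \<le> c \<Longrightarrow> set s \<subseteq> {..c}"
  using sorted_le_last by (force simp: ndseq_le_def)

text \<open>The order compares last entries first, so all entries of a predecessor are at most
  \<open>last s\<close>; only finitely many sequences of length at most \<open>k\<close> are bounded
  in this way.\<close>

lemma finite_predecessors: "finite {u \<in> ndseq_le k. u \<lhd> s}"
proof (rule finite_subset)
  show "{u \<in> ndseq_le k. u \<lhd> s} \<subseteq> {u \<in> ndseq_le k. set u \<subseteq> {..last s}}"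
  proof safe
    fix u x assume "u \<in> ndseq_le k" "u \<lhd> s" "x \<in> set u"
    then show "x \<le> last s"
      using seq_less_last_le[of u s] ndseq_le_set_last[of u k "last s"] by fastforce
  qed
qed (rule finite_bounded_ndseq)

lemma finite_predecessors': "finite {u \<in> ndseq k. u \<lhd> s}"
  by (rule finite_subset[OF _ finite_predecessors[of k s]]) (use ndseq_subset in auto)

text \<open>\<open>idx\<close> numbers the leaves from 0, so that the first \<open>n\<close> leaves
  become \<open>idx k s < n\<close>. \<open>rank\<close> also counts inner nodes and is strictly
  increasing on all of them, which later keeps constructed trees free of ties.\<close>

definition idx :: "nat \<Rightarrow> nat list \<Rightarrow> nat" where
  "idx k s = card {u \<in> ndseq k. u \<lhd> s}"

definition rank :: "nat \<Rightarrow> nat list \<Rightarrow> nat" where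
  "rank k s = card {u \<in> ndseq_le k. u \<lhd> s}"

lemma idx_mono: "s \<lhd> t \<Longrightarrow> idx k s \<le> idx k t"
  unfolding idx_def by (rule card_mono[OF finite_predecessors']) (use seq_less_trans in blast)

lemma idx_strict_mono: "s \<lhd> t \<Longrightarrow> s \<in> ndseq k \<Longrightarrow> idx k s < idx k t"
  unfolding idx_def
  by (rule psubset_card_mono[OF finite_predecessors']) (use seq_less_trans seq_less_irrefl in blast)

lemma rank_strict_mono: "s \<lhd> t \<Longrightarrow> s \<in> ndseq_le k \<Longrightarrow> rank k s < rank k t"
  unfolding rank_def
  by (rule psubset_card_mono[OF finite_predecessors]) (use seq_less_trans seq_less_irrefl in blast)

lemma idx_inj: "inj_on (idx k) (ndseq k)"
  by (rule inj_onI) (metis idx_strict_mono nat_less_le seq_less_total)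

lemma zero_ndseq: "replicate k 0 \<in> ndseq k"
  by (simp add: ndseq_def)

lemma sorted_last_zero:
  assumes "sorted (s :: nat list)" "last s = 0"
  shows "s = replicate (length s) 0"
  using sorted_le_last[OF assms(1)] assms(2) by (metis le_zero_eq replicate_length_same)

lemma zero_seq_less:
  assumes "s \<in> ndseq_le k" "s \<noteq> []" "s \<noteq> replicate (length s) 0" "1 \<le> m"
  shows "replicate m 0 \<lhd> s"
proof (rule last_less_imp_seq_less)
  have "last s \<noteq> 0"
    using sorted_last_zero[of s] assms by (auto simp: ndseq_le_def)
  then show "last (replicate m 0) < last s"
    using assms by simp
qed (use assms in auto)

lemma zero_least:
  assumes "s \<in> ndseq k" "s \<noteq> replicate k 0" "1 \<le> k"
  shows "replicate k 0 \<lhd> s"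
  using zero_seq_less[of s k k] assms ndseq_nonempty[of s k] ndseq_subset by (auto simp: ndseq_def ndseq_le_def)

lemma idx_zero: "1 \<le> k \<Longrightarrow> idx k (replicate k 0) = 0"
  using zero_least[of _ k] seq_less_asym seq_less_irrefl
  by (auto simp: idx_def finite_predecessors')

lemma infinite_ndseq: "1 \<le> k \<Longrightarrow> infinite (ndseq k)"
proof
  assume k: "1 \<le> k" "finite (ndseq k)"
  have "inj (\<lambda>c::nat. replicate k c)"
    using k(1) by (auto simp: inj_def)
  moreover have "range (\<lambda>c::nat. replicate k c) \<subseteq> ndseq k"
    by (auto simp: ndseq_def sorted_replicate)
  ultimately show False
    using k(2) finite_subset infinite_UNIV_nat finite_imageD by blast
qed

text \<open>Being injective on an infinite set, \<open>idx\<close> exceeds \<open>i\<close> at some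
  \<open>t\<close>. It maps the predecessors of \<open>t\<close> into the numbers below
  \<open>idx k t\<close>, and a count shows that all of these are hit.\<close>

lemma idx_surj:
  assumes "1 \<le> k"
  shows "\<exists>s\<in>ndseq k. idx k s = i"
proof -
  have "infinite (idx k ` ndseq k)"
    using infinite_ndseq[OF assms] idx_inj finite_imageD by blast
  then obtain t where t: "t \<in> ndseq k" "i < idx k t"
    by (auto simp: infinite_nat_iff_unbounded)
  let ?P = "{u \<in> ndseq k. u \<lhd> t}"
  have "idx k ` ?P = {..<idx k t}"
  proof (rule card_subset_eq)
    show "card (idx k ` ?P) = card {..<idx k t}"
      using inj_on_subset[OF idx_inj, of ?P k] by (subst card_image) (auto simp: idx_def)
  qed (auto intro: idx_strict_mono)
  then show ?thesis using t(2) by (metis (no_types, lifting) imageE lessThan_iff mem_Collect_eq)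
qed

text \<open>Last entries are compared first, so a bound on them cuts off an initial segment of the
  well-order. Images of such sets under trees are therefore approximations.\<close>

lemma idx_initial:
  assumes "1 \<le> k"
  shows "{s \<in> ndseq k. last s \<le> c} = {s \<in> ndseq k. idx k s < card {s \<in> ndseq k. last s \<le> c}}"
    (is "?I = ?J")
proof -
  have fin: "finite ?I"
    by (rule finite_subset[OF _ finite_bounded_ndseq[of k c]])
      (use ndseq_subset ndseq_le_set_last in blast)
  have "idx k s < card ?I" if "s \<in> ?I" for s
    unfolding idx_def
  proof (rule psubset_card_mono[OF fin])
    have "last u \<le> c" if "u \<in> ndseq k" "u \<lhd> s" for u
      using seq_less_last_le[OF that(2) ndseq_nonempty[OF that(1) assms]] \<open>s \<in> ?I\<close> by auto
    then show "{u \<in> ndseq k. u \<lhd> s} \<subset> ?I"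
      using that seq_less_irrefl by blast
  qed
  moreover have "card ?I \<le> idx k s" if "s \<in> ndseq k" "c < last s" for s
    unfolding idx_def
    by (rule card_mono[OF finite_predecessors'])
      (use that assms ndseq_nonempty last_less_imp_seq_less in fastforce)
  ultimately show ?thesis
    by (auto simp: not_less[symmetric])
qed

section \<open>Elementary properties of trees\<close>

lemma E_tree_in: "E_tree k X \<Longrightarrow> s \<in> ndseq_le k \<Longrightarrow> X s \<in> ndseq_le k"
  by (auto simp: E_tree_def)

lemma E_tree_less_iff:
  assumes "E_tree k X" "s \<in> ndseq_le k" "t \<in> ndseq_le k"
  shows "X s \<lhd> X t \<longleftrightarrow> s \<lhd> t"
  using assms seq_less_total[of s t] seq_less_asym seq_less_irrefl unfolding E_tree_def by metis

lemma E_tree_inj: "E_tree k X \<Longrightarrow> inj_on X (ndseq_le k)"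
  by (rule inj_onI) (metis E_tree_less_iff seq_less_irrefl seq_less_total)

text \<open>Extend \<open>s\<close> to a leaf \<open>u\<close>. Along the \<open>k + 1\<close>
  initial segments of \<open>u\<close> the lengths of the images increase strictly and stay at most
  \<open>k\<close>, so they must be \<open>0, ..., k\<close>.\<close>

lemma E_tree_length:
  assumes X: "E_tree k X" and s: "s \<in> ndseq_le k"
  shows "length (X s) = length s"
proof -
  \<comment> \<open>For \<open>s = []\<close> the value of \<open>last s\<close> is unspecified, but
    any constant sequence serves.\<close>
  define u where "u = s @ replicate (k - length s) (last s)"
  have u: "u \<in> ndseq k"
    using s sorted_le_last by (auto simp: u_def ndseq_def ndseq_le_def sorted_append)
  have step: "length (X (take i u)) < length (X (take (Suc i) u))" if "i < k" for i
  proof -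
    have "strict_prefix (take i u) (take (Suc i) u)"
      using that u by (auto simp: strict_prefix_def ndseq_def take_Suc_conv_app_nth)
    then have "strict_prefix (X (take i u)) (X (take (Suc i) u))"
      using X u ndseq_subset ndseq_le_take[of u k] unfolding E_tree_def by blast
    then show ?thesis by (rule prefix_length_less)
  qed
  have lower: "i \<le> k \<Longrightarrow> i \<le> length (X (take i u))" for i
  proof (induction i)
    case (Suc i)
    then show ?case using step[of i] by auto
  qed simp
  have upper: "i \<le> k \<Longrightarrow> length (X (take (k - i) u)) \<le> k - i" for i
  proof (induction i)
    case 0
    then show ?case
      using E_tree_in[OF X, of u] u ndseq_subset[of k] by (auto simp: ndseq_le_def ndseq_def)
  next
    case (Suc i)
    then show ?case using step[of "k - Suc i"] by (auto simp: Suc_diff_Suc)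
  qed
  have "length s \<le> k" "take (length s) u = s"
    using s by (auto simp: u_def ndseq_le_def)
  then show ?thesis using lower[of "length s"] upper[of "k - length s"] by auto
qed

lemma E_tree_ndseq: "E_tree k X \<Longrightarrow> s \<in> ndseq k \<Longrightarrow> X s \<in> ndseq k"
  using E_tree_length[of k X s] E_tree_in[of k X s] ndseq_subset by (auto simp: ndseq_def ndseq_le_def)

lemma E_tree_take:
  assumes X: "E_tree k X" and s: "s \<in> ndseq_le k"
  shows "X (take n s) = take n (X s)"
proof (cases "n < length s")
  case True
  then have "strict_prefix (take n s) s"
    by (metis length_take min.absorb4 nat_less_le strict_prefix_def take_is_prefix)
  then have "strict_prefix (X (take n s)) (X s)"
    using X s ndseq_le_take[OF s] unfolding E_tree_def by blast
  moreover have "length (X (take n s)) = n"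
    using E_tree_length[OF X ndseq_le_take[OF s]] True by simp
  ultimately show ?thesis
    by (auto simp: strict_prefix_def prefix_def)
next
  case False
  then show ?thesis using E_tree_length[OF X s] by simp
qed

text \<open>A tree preserves and reflects the order, so \<open>X s\<close> has as many predecessors
  in the image as \<open>s\<close> has among the leaves.\<close>

lemma approx_E_tree:
  assumes X: "E_tree k X"
  shows "approx n (X ` ndseq k) = X ` {s \<in> ndseq k. idx k s < n}"
proof -
  have "card {y \<in> X ` ndseq k. y \<lhd> X s} = idx k s" if s: "s \<in> ndseq k" for s
  proof -
    have "{y \<in> X ` ndseq k. y \<lhd> X s} = X ` {u \<in> ndseq k. u \<lhd> s}"
      using E_tree_less_iff[OF X] s ndseq_subset by blast
    then show ?thesis
      using inj_on_subset[OF E_tree_inj[OF X], of "{u \<in> ndseq k. u \<lhd> s}"] ndseq_subset[of k]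
      by (simp add: idx_def card_image subset_eq)
  qed
  then show ?thesis by (auto simp: approx_def)
qed

lemma AR_n_iff:
  "E \<in> AR_n k n \<longleftrightarrow> (\<exists>X. E_tree k X \<and> E = X ` {s \<in> ndseq k. idx k s < n})"
  using approx_E_tree by (fastforce simp: AR_n_def E_space_def)

lemma AR_iff:
  "E \<in> AR k \<longleftrightarrow> (\<exists>X n. E_tree k X \<and> 1 \<le> n \<and> E = X ` {s \<in> ndseq k. idx k s < n})"
  by (auto simp: AR_def AR_n_iff)

lemma AR_subset: "E \<in> AR k \<Longrightarrow> E \<subseteq> ndseq k"
  using E_tree_ndseq by (auto simp: AR_iff)

lemma AR_nonempty: "E \<in> AR k \<Longrightarrow> 1 \<le> k \<Longrightarrow> E \<noteq> {}"
  using zero_ndseq[of k] idx_zero[of k] by (auto simp: AR_iff)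

definition cone :: "nat list \<Rightarrow> nat list set" where
  "cone s = {v. prefix s v}"

text \<open>In a tree \<open>X\<close> with leaves \<open>E\<close>, the nodes off the branch of \<open>(0,\<dots>,0)\<close> come after the least leaf
  \<open>X (0,\<dots>,0)\<close>, so at most one node of a given length can end below the level of \<open>E\<close>.\<close>

lemma AR_unique_cone:
  assumes E: "E \<in> AR k" and k: "1 \<le> k" and lev: "\<And>v. v \<in> E \<Longrightarrow> n \<le> last v"
    and v: "v \<in> E" "v \<in> cone (s @ [a])" "a < n"
    and w: "w \<in> E" "w \<in> cone (s @ [b])" "b < n"
  shows "a = b"
proof -
  obtain X m where X: "E_tree k X" "1 \<le> m" and E_eq: "E = X ` {s \<in> ndseq k. idx k s < m}"
    using E by (auto simp: AR_iff)
  have lev0: "n \<le> last (X (replicate k 0))"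
    using lev X(2) zero_ndseq[of k] idx_zero[OF k] by (auto simp: E_eq)
  have *: "take (Suc (length s)) u = replicate (Suc (length s)) 0"
    if u: "u \<in> ndseq k" "X u \<in> cone (s @ [c])" "c < n" for u c
  proof (rule ccontr)
    assume neq: "take (Suc (length s)) u \<noteq> replicate (Suc (length s)) 0"
    have u': "u \<in> ndseq_le k" using u(1) ndseq_subset by auto
    have Xt: "X (take (Suc (length s)) u) = s @ [c]"
      using u(2) E_tree_take[OF X(1) u'] by (auto simp: cone_def prefix_def)
    have len: "length (take (Suc (length s)) u) = Suc (length s)"
      using E_tree_length[OF X(1) ndseq_le_take[OF u', of "Suc (length s)"]] Xt by simp
    have "replicate k 0 \<lhd> take (Suc (length s)) u"
      using neq len by (intro zero_seq_less[OF ndseq_le_take[OF u'] _ _ k]) auto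
    moreover have "replicate k 0 \<in> ndseq_le k"
      using zero_ndseq ndseq_subset by blast
    ultimately have "X (replicate k 0) \<lhd> s @ [c]"
      using E_tree_less_iff[OF X(1) _ ndseq_le_take[OF u', of "Suc (length s)"]] Xt by metis
    moreover have "X (replicate k 0) \<noteq> []"
      using E_tree_length[OF X(1), of "replicate k 0"] zero_ndseq[of k] ndseq_subset k by fastforce
    ultimately show False
      using seq_less_last_le lev0 u(3) by fastforce
  qed
  obtain u u' where u: "u \<in> ndseq k" "v = X u" "u' \<in> ndseq k" "w = X u'"
    using v(1) w(1) by (auto simp: E_eq)
  have "take (Suc (length s)) u = take (Suc (length s)) u'"
    using *[of u a] *[of u' b] u v w by auto
  then have "take (Suc (length s)) v = take (Suc (length s)) w"
    using u E_tree_take[OF X(1)] ndseq_subset by (metis subsetD)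
  then show ?thesis
    using v(2) w(2) by (auto simp: cone_def prefix_def)
qed

section \<open>Construction of trees by prescribing the last entry of each node\<close>

definition tree :: "(nat list \<Rightarrow> nat) \<Rightarrow> nat list \<Rightarrow> nat list" where
  "tree g s = map (\<lambda>i. g (take (Suc i) s)) [0..<length s]"

lemma length_tree [simp]: "length (tree g s) = length s"
  by (simp add: tree_def)

lemma tree_eq_Nil [simp]: "tree g s = [] \<longleftrightarrow> s = []"
  by (simp add: tree_def)

lemma nth_tree: "i < length s \<Longrightarrow> tree g s ! i = g (take (Suc i) s)"
  by (simp add: tree_def)

lemma last_tree: "s \<noteq> [] \<Longrightarrow> last (tree g s) = g s"
  by (simp add: last_conv_nth nth_tree)

lemma tree_append: "tree g (s @ u) = tree g s @ map (\<lambda>i. g (s @ take (Suc i) u)) [0..<length u]"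
  by (rule nth_equalityI) (auto simp: nth_tree nth_append Suc_diff_le)

lemma strict_prefix_tree: "strict_prefix s t \<Longrightarrow> strict_prefix (tree g s) (tree g t)"
  by (auto simp: strict_prefix_def prefix_def tree_append)

text \<open>Initial segments are respected by construction. \<open>mono\<close> makes the images
  sorted and compares their last entries. When these agree, \<open>tie\<close> reduces to the
  lexicographic order, and \<open>sib\<close> transports that order: two sequences and their images
  first differ at the same place and in the same direction.\<close>

lemma E_tree_tree:
  assumes mono: "\<And>s t. s \<in> ndseq_le k \<Longrightarrow> t \<in> ndseq_le k \<Longrightarrow> s \<noteq> [] \<Longrightarrow> s \<lhd> t \<Longrightarrow> g s \<le> g t"
    and sib: "\<And>s a b. s @ [a] \<in> ndseq_le k \<Longrightarrow> s @ [b] \<in> ndseq_le k \<Longrightarrow> a < b \<Longrightarrow> g (s @ [a]) < g (s @ [b])"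
    and tie: "\<And>s t. s \<in> ndseq_le k \<Longrightarrow> t \<in> ndseq_le k \<Longrightarrow> s \<noteq> [] \<Longrightarrow> s \<lhd> t \<Longrightarrow> g s = g t \<Longrightarrow>
      (s, t) \<in> lex_less"
  shows "E_tree k (tree g)"
  unfolding E_tree_def
proof (intro conjI ballI impI)
  show "tree g \<in> ndseq_le k \<rightarrow> ndseq_le k"
  proof
    fix s assume s: "s \<in> ndseq_le k"
    have "g (take (Suc i) s) \<le> g (take (Suc j) s)" if "i < j" "j < length s" for i j
    proof (rule mono)
      have "strict_prefix (take (Suc i) s) (take (Suc j) s)"
        using that take_is_prefix[of "Suc i" "take (Suc j) s"]
        by (auto simp: strict_prefix_def dest: arg_cong[where f = length])
      then show "take (Suc i) s \<lhd> take (Suc j) s"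
        by (rule strict_prefix_imp_seq_less) (use s in \<open>auto simp: ndseq_le_def sorted_take_nat\<close>)
    qed (use s that ndseq_le_take in auto)
    then have "sorted (tree g s)"
      by (auto simp: sorted_iff_nth_mono_less nth_tree)
    then show "tree g s \<in> ndseq_le k"
      using s by (auto simp: ndseq_le_def)
  qed
  fix s t assume s: "s \<in> ndseq_le k" and t: "t \<in> ndseq_le k"
  show "strict_prefix s t \<Longrightarrow> strict_prefix (tree g s) (tree g t)"
    by (rule strict_prefix_tree)
  assume st: "s \<lhd> t"
  have lex: "(tree g s, tree g t) \<in> lex_less" if "(s, t) \<in> lex_less"
    using that
  proof (cases rule: lex_less_cases)
    case prefix
    then show ?thesis by (intro strict_prefix_lex_less strict_prefix_tree)
  next
    case (diff u a b s' t')
    have "u @ [a] \<in> ndseq_le k" "u @ [b] \<in> ndseq_le k"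
      using ndseq_le_take[OF s, of "Suc (length u)"] ndseq_le_take[OF t, of "Suc (length u)"] diff
      by auto
    then have "g (u @ [a]) < g (u @ [b])"
      using sib diff by auto
    then show ?thesis
      unfolding diff tree_append
      by (intro lexord_append_leftI) (simp add: upt_conv_Cons del: upt_Suc)
  qed
  show "tree g s \<lhd> tree g t"
  proof (cases "s = []")
    case True
    then show ?thesis using st by (auto simp: seq_less_def)
  next
    case False
    then have "t \<noteq> []" using st by (auto simp: seq_less_def)
    then show ?thesis
      using mono[OF s t False st] tie[OF s t False st] lex False
      by (auto simp: seq_less_def last_tree)
  qed
qed

section \<open>The norm on finitely supported vectors\<close>

definition supp :: "('i \<Rightarrow> real) \<Rightarrow> 'i set" where
  "supp x = {v. x v \<noteq> 0}"

lemma c00_iff: "x \<in> c00 k \<longleftrightarrow> finite (supp x) \<and> supp x \<subseteq> ndseq k"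
  by (simp add: c00_def supp_def)

lemma c00_zero: "(\<lambda>v. 0) \<in> c00 k"
  by (simp add: c00_def)

lemma c00_add: "x \<in> c00 k \<Longrightarrow> y \<in> c00 k \<Longrightarrow> (\<lambda>v. x v + y v) \<in> c00 k"
proof -
  assume "x \<in> c00 k" "y \<in> c00 k"
  moreover have "supp (\<lambda>v. x v + y v) \<subseteq> supp x \<union> supp y"
    by (auto simp: supp_def)
  ultimately show ?thesis
    unfolding c00_iff by (meson finite_UnI finite_subset le_sup_iff subset_trans)
qed

lemma c00_scale: "x \<in> c00 k \<Longrightarrow> (\<lambda>v. c * x v) \<in> c00 k"
  unfolding c00_iff by (auto intro: finite_subset[of _ "supp x"] simp: supp_def)

lemma c00_sum: "(\<And>i. i \<in> I \<Longrightarrow> x i \<in> c00 k) \<Longrightarrow> (\<lambda>v. \<Sum>i\<in>I. x i v) \<in> c00 k"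
  by (induction I rule: infinite_finite_induct) (auto simp: c00_zero c00_add)

lemma c00_restr: "x \<in> c00 k \<Longrightarrow> restr E x \<in> c00 k"
  unfolding c00_iff by (auto intro: finite_subset[of _ "supp x"] simp: supp_def restr_def)

lemma restr_restr: "restr E (restr F x) = restr (E \<inter> F) x"
  by (auto simp: restr_def fun_eq_iff)

lemma restr_supp: "restr (E \<inter> supp x) x = restr E x"
  by (auto simp: restr_def fun_eq_iff supp_def)

lemma restr_add: "restr E (\<lambda>v. x v + y v) = (\<lambda>v. restr E x v + restr E y v)"
  by (auto simp: restr_def)

lemma restr_scale: "restr E (\<lambda>v. c * x v) = (\<lambda>v. c * restr E x v)"
  by (auto simp: restr_def)

lemma restr_sum: "restr E (\<lambda>v. \<Sum>i\<in>I. x i v) = (\<lambda>v. \<Sum>i\<in>I. restr E (x i) v)"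
  by (auto simp: restr_def)

text \<open>A crude norm that dominates every \<open>pre_norm\<close>, so that the supremum in
  \<open>T_norm\<close> is taken over a bounded set.\<close>

definition l1 :: "('i \<Rightarrow> real) \<Rightarrow> real" where
  "l1 x = (\<Sum>v\<in>supp x. \<bar>x v\<bar>)"

lemma l1_nonneg: "0 \<le> l1 x"
  by (simp add: l1_def sum_nonneg)

text \<open>The markers separate consecutive members only; the chain from \<open>i\<close> to
  \<open>j\<close> passes through points of the members in between, which are nonempty.\<close>

lemma admissible_nth_less:
  assumes adm: "admissible k d Es" and k: "1 \<le> k" and ij: "i < j" "j < length Es"
    and v: "v \<in> Es ! i" "w \<in> Es ! j"
  shows "v \<lhd> w"
proof -
  obtain vs where Es: "set Es \<subseteq> AR k"
    and le: "\<And>i w. i < length Es \<Longrightarrow> w \<in> Es ! i \<Longrightarrow> vs ! i \<lhd> w \<or> vs ! i = w"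
    and less: "\<And>i v. Suc i < length Es \<Longrightarrow> v \<in> Es ! i \<Longrightarrow> v \<lhd> vs ! Suc i"
    using adm unfolding admissible_def block_le_def block_less_def by (metis singletonI)
  have ne: "\<exists>u. u \<in> Es ! i" if "i < length Es" for i
    using Es that AR_nonempty[OF _ k] nth_mem by blast
  have "\<forall>w\<in>Es ! j. v \<lhd> w"
    using ij
  proof (induction j)
    case (Suc j)
    have "v \<lhd> vs ! Suc j"
    proof (cases "i = j")
      case True
      then show ?thesis using less Suc.prems v(1) by auto
    next
      case False
      then show ?thesis
        using Suc ne[of j] less[of j] seq_less_trans by (metis Suc_lessD less_antisym)
    qed
    then show ?case using le[of "Suc j"] Suc.prems seq_less_trans by blast
  qed simp
  then show ?thesis using v(2) by blast
qed

lemma admissible_disjoint: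
  assumes "admissible k d Es" "1 \<le> k" "i < length Es" "j < length Es" "i \<noteq> j"
  shows "Es ! i \<inter> Es ! j = {}"
  using admissible_nth_less[OF assms(1,2), of i j] admissible_nth_less[OF assms(1,2), of j i]
    assms(3-5) seq_less_irrefl by (metis disjoint_iff nat_neq_iff)

text \<open>Ensures that \<open>Max\<close> in \<open>pre_norm\<close> ranges over a nonempty set.
  The witness is the least leaf alone, with itself as marker.\<close>

lemma admissible_exists:
  assumes "1 \<le> k" "1 \<le> d"
  shows "\<exists>Es. admissible k d Es"
proof -
  let ?z = "replicate k (0::nat)"
  have tr: "E_tree k id"
    by (auto simp: E_tree_def)
  have "{s \<in> ndseq k. idx k s < 1} = {?z}"
    using idx_zero[OF assms(1)] zero_ndseq[of k] idx_strict_mono[OF zero_least[OF _ _ assms(1)] zero_ndseq]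
    by force
  then have z: "{?z} \<in> AR_n k 1"
    using tr by (auto simp: AR_n_iff)
  then have "{?z} \<in> AR k" "{?z} \<in> A_fam k d"
    using assms(2) by (auto simp: AR_def A_fam_def)
  then have "admissible k d [{?z}]"
    using assms by (auto simp: admissible_def block_le_def intro!: exI[of _ "[?z]"])
  then show ?thesis by blast
qed

text \<open>Only the traces on the finite support matter, and there are finitely many lists of at
  most \<open>d\<close> subsets of it. So \<open>Max\<close> in \<open>pre_norm\<close> is a true
  maximum.\<close>

lemma finite_admissible_values:
  assumes "x \<in> c00 k"
  shows "finite {(\<Sum>i<length Es. f (restr (Es ! i) x)) | Es. admissible k d Es}"
proof (rule finite_subset)
  let ?L = "{Fs. set Fs \<subseteq> Pow (supp x) \<and> length Fs \<le> d}"
  show "finite ((\<lambda>Fs. \<Sum>i<length Fs. f (restr (Fs ! i) x)) ` ?L)"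
    using assms by (intro finite_imageI finite_lists_length_le) (simp add: c00_iff)
  show "{(\<Sum>i<length Es. f (restr (Es ! i) x)) | Es. admissible k d Es} \<subseteq>
      (\<lambda>Fs. \<Sum>i<length Fs. f (restr (Fs ! i) x)) ` ?L"
  proof safe
    fix Es assume "admissible k d Es"
    then have "map (\<lambda>E. E \<inter> supp x) Es \<in> ?L"
      by (auto simp: admissible_def)
    moreover have "(\<Sum>i<length Es. f (restr (Es ! i) x)) =
        (\<Sum>i<length (map (\<lambda>E. E \<inter> supp x) Es). f (restr (map (\<lambda>E. E \<inter> supp x) Es ! i) x))"
      by (auto intro!: sum.cong simp: restr_supp)
    ultimately show "(\<Sum>i<length Es. f (restr (Es ! i) x)) \<in>
        (\<lambda>Fs. \<Sum>i<length Fs. f (restr (Fs ! i) x)) ` ?L"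
      by blast
  qed
qed

lemma finite_abs_range:
  assumes "x \<in> c00 k"
  shows "finite ((\<lambda>v. \<bar>x v\<bar>) ` ndseq k)"
  by (rule finite_subset[of _ "insert 0 ((\<lambda>v. \<bar>x v\<bar>) ` supp x)"])
    (use assms in \<open>auto simp: c00_iff supp_def\<close>)

section \<open>The approximating norms and their limit\<close>

context
  fixes d :: nat and \<theta> :: real
  assumes d: "1 \<le> d" and \<theta>: "0 < \<theta>" "\<theta> < 1"
begin

lemma pre_norm_0_le_iff:
  assumes "x \<in> c00 k"
  shows "pre_norm k d \<theta> 0 x \<le> c \<longleftrightarrow> (\<forall>v\<in>ndseq k. \<bar>x v\<bar> \<le> c)"
  unfolding pre_norm.simps
  by (subst Max_le_iff[OF finite_abs_range[OF assms]]) (use zero_ndseq[of k] in auto)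

text \<open>Replaces the maximum by a family of inequalities, the form in which the inductions on
  \<open>j\<close> use the recursion.\<close>

lemma pre_norm_Suc_le_iff:
  assumes "x \<in> c00 k" "1 \<le> k"
  shows "pre_norm k d \<theta> (Suc j) x \<le> c \<longleftrightarrow> pre_norm k d \<theta> j x \<le> c \<and>
    (\<forall>Es. admissible k d Es \<longrightarrow> \<theta> * (\<Sum>i<length Es. pre_norm k d \<theta> j (restr (Es ! i) x)) \<le> c)"
proof -
  let ?S = "{(\<Sum>i<length Es. pre_norm k d \<theta> j (restr (Es ! i) x)) | Es. admissible k d Es}"
  have S: "finite ?S" "?S \<noteq> {}"
    using finite_admissible_values[OF assms(1)] admissible_exists[OF assms(2) d] by auto
  have "\<theta> * Max ?S \<le> c \<longleftrightarrow> Max ?S \<le> c / \<theta>"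
    using \<theta>(1) by (simp add: field_simps)
  also have "\<dots> \<longleftrightarrow> (\<forall>s\<in>?S. s \<le> c / \<theta>)"
    using S by (rule Max_le_iff)
  also have "\<dots> \<longleftrightarrow> (\<forall>s\<in>?S. \<theta> * s \<le> c)"
    using \<theta>(1) by (simp add: field_simps)
  also have "\<dots> \<longleftrightarrow> (\<forall>Es. admissible k d Es \<longrightarrow>
      \<theta> * (\<Sum>i<length Es. pre_norm k d \<theta> j (restr (Es ! i) x)) \<le> c)"
    by blast
  finally show ?thesis by simp
qed

lemma pre_norm_mono: "j \<le> j' \<Longrightarrow> pre_norm k d \<theta> j x \<le> pre_norm k d \<theta> j' x"
  by (rule lift_Suc_mono_le[of "\<lambda>j. pre_norm k d \<theta> j x"]) auto

declare pre_norm.simps [simp del]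

lemma abs_le_pre_norm:
  assumes "x \<in> c00 k"
  shows "\<bar>x v\<bar> \<le> pre_norm k d \<theta> j x"
proof -
  have le: "\<forall>v\<in>ndseq k. \<bar>x v\<bar> \<le> pre_norm k d \<theta> j x"
    using pre_norm_0_le_iff[OF assms] pre_norm_mono[of 0 j k x] by blast
  show ?thesis
  proof (cases "v \<in> ndseq k")
    case False
    then have "x v = 0" using assms by (auto simp: c00_iff supp_def)
    then show ?thesis using le zero_ndseq[of k] by (metis abs_ge_zero abs_zero order_trans)
  qed (use le in blast)
qed

lemma pre_norm_nonneg: "x \<in> c00 k \<Longrightarrow> 0 \<le> pre_norm k d \<theta> j x"
  using abs_le_pre_norm[of x k] by (meson abs_ge_zero order_trans)

context
  fixes k :: nat
  assumes k: "1 \<le> k"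
begin

text \<open>Members of an admissible sequence are disjoint, so the \<open>l1\<close> norms of the
  pieces add up to at most \<open>l1 x\<close>, and the factor \<open>\<theta> < 1\<close> only
  helps.\<close>

lemma pre_norm_le_l1:
  assumes "x \<in> c00 k"
  shows "pre_norm k d \<theta> j x \<le> l1 x"
  using assms
proof (induction j arbitrary: x)
  case 0
  have "\<bar>x v\<bar> \<le> l1 x" for v
    using 0 member_le_sum[of v "supp x" "\<lambda>v. \<bar>x v\<bar>"] l1_nonneg[of x]
    by (cases "v \<in> supp x") (auto simp: l1_def c00_iff supp_def)
  then show ?case
    using pre_norm_0_le_iff[OF 0] by blast
next
  case (Suc j)
  have fin: "finite (supp x)" using Suc.prems by (simp add: c00_iff)
  have "\<theta> * (\<Sum>i<length Es. pre_norm k d \<theta> j (restr (Es ! i) x)) \<le> l1 x" if adm: "admissible k d Es" for Es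
  proof -
    have "(\<Sum>i<length Es. pre_norm k d \<theta> j (restr (Es ! i) x)) \<le> (\<Sum>i<length Es. l1 (restr (Es ! i) x))"
      using Suc by (intro sum_mono) (simp add: c00_restr)
    also have "\<dots> = (\<Sum>i<length Es. \<Sum>v\<in>supp x \<inter> Es ! i. \<bar>x v\<bar>)"
      unfolding l1_def by (intro sum.cong) (auto simp: supp_def restr_def)
    also have "\<dots> = (\<Sum>v\<in>(\<Union>i<length Es. supp x \<inter> Es ! i). \<bar>x v\<bar>)"
      using fin admissible_disjoint[OF adm k] by (intro sum.UNION_disjoint[symmetric]) blast+
    also have "\<dots> \<le> l1 x"
      unfolding l1_def using fin by (intro sum_mono2) auto
    finally have "\<theta> * (\<Sum>i<length Es. pre_norm k d \<theta> j (restr (Es ! i) x)) \<le> \<theta> * l1 x"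
      using \<theta> by simp
    also have "\<dots> \<le> l1 x"
      using \<theta> l1_nonneg[of x] by (intro mult_left_le_one_le) auto
    finally show ?thesis .
  qed
  then show ?case
    using pre_norm_Suc_le_iff[OF Suc.prems k] Suc by blast
qed

lemma pre_norm_restr_le:
  assumes "x \<in> c00 k"
  shows "pre_norm k d \<theta> j (restr E x) \<le> pre_norm k d \<theta> j x"
  using assms
proof (induction j arbitrary: x)
  case 0
  then show ?case
    using pre_norm_0_le_iff[OF c00_restr[OF 0]] abs_le_pre_norm[OF 0, of _ 0] pre_norm_nonneg[OF 0, of 0]
    by (auto simp: restr_def)
next
  case (Suc j)
  have "\<theta> * (\<Sum>i<length Es. pre_norm k d \<theta> j (restr (Es ! i) (restr E x))) \<le> pre_norm k d \<theta> (Suc j) x"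
    if adm: "admissible k d Es" for Es
  proof -
    have "(\<Sum>i<length Es. pre_norm k d \<theta> j (restr (Es ! i) (restr E x))) \<le>
        (\<Sum>i<length Es. pre_norm k d \<theta> j (restr (Es ! i) x))"
    proof (rule sum_mono)
      fix i
      show "pre_norm k d \<theta> j (restr (Es ! i) (restr E x)) \<le> pre_norm k d \<theta> j (restr (Es ! i) x)"
        using Suc.IH[OF c00_restr[OF Suc.prems], of "Es ! i"] by (simp add: restr_restr Int_commute)
    qed
    then have "\<theta> * (\<Sum>i<length Es. pre_norm k d \<theta> j (restr (Es ! i) (restr E x))) \<le>
        \<theta> * (\<Sum>i<length Es. pre_norm k d \<theta> j (restr (Es ! i) x))"
      using \<theta> by simp
    also have "\<dots> \<le> pre_norm k d \<theta> (Suc j) x"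
      using pre_norm_Suc_le_iff[OF Suc.prems k, of j] adm by blast
    finally show ?thesis .
  qed
  moreover have "pre_norm k d \<theta> j (restr E x) \<le> pre_norm k d \<theta> (Suc j) x"
    using Suc pre_norm_mono[of j "Suc j" k x] by (meson le_SucI order_refl order_trans)
  ultimately show ?case
    using pre_norm_Suc_le_iff[OF c00_restr[OF Suc.prems] k] by blast
qed

lemma pre_norm_triangle:
  assumes "x \<in> c00 k" "y \<in> c00 k"
  shows "pre_norm k d \<theta> j (\<lambda>v. x v + y v) \<le> pre_norm k d \<theta> j x + pre_norm k d \<theta> j y"
  using assms
proof (induction j arbitrary: x y)
  case 0
  have "\<bar>x v + y v\<bar> \<le> pre_norm k d \<theta> 0 x + pre_norm k d \<theta> 0 y" for v
    using abs_le_pre_norm[OF 0(1), of v 0] abs_le_pre_norm[OF 0(2), of v 0] by linarith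
  then show ?case
    using pre_norm_0_le_iff[OF c00_add[OF 0]] by blast
next
  case (Suc j)
  note xy = Suc.prems
  have "\<theta> * (\<Sum>i<length Es. pre_norm k d \<theta> j (restr (Es ! i) (\<lambda>v. x v + y v))) \<le>
      pre_norm k d \<theta> (Suc j) x + pre_norm k d \<theta> (Suc j) y"
    if adm: "admissible k d Es" for Es
  proof -
    have "(\<Sum>i<length Es. pre_norm k d \<theta> j (restr (Es ! i) (\<lambda>v. x v + y v))) \<le>
        (\<Sum>i<length Es. pre_norm k d \<theta> j (restr (Es ! i) x) + pre_norm k d \<theta> j (restr (Es ! i) y))"
      unfolding restr_add using xy by (intro sum_mono Suc.IH c00_restr)
    then have "\<theta> * (\<Sum>i<length Es. pre_norm k d \<theta> j (restr (Es ! i) (\<lambda>v. x v + y v))) \<le>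
        \<theta> * (\<Sum>i<length Es. pre_norm k d \<theta> j (restr (Es ! i) x)) +
        \<theta> * (\<Sum>i<length Es. pre_norm k d \<theta> j (restr (Es ! i) y))"
      using \<theta> by (simp add: sum.distrib flip: distrib_left)
    also have "\<dots> \<le> pre_norm k d \<theta> (Suc j) x + pre_norm k d \<theta> (Suc j) y"
      using pre_norm_Suc_le_iff[OF xy(1) k, of j] pre_norm_Suc_le_iff[OF xy(2) k, of j] adm
      by (intro add_mono) blast+
    finally show ?thesis .
  qed
  moreover have "pre_norm k d \<theta> j (\<lambda>v. x v + y v) \<le> pre_norm k d \<theta> (Suc j) x + pre_norm k d \<theta> (Suc j) y"
    using Suc.IH[OF xy] pre_norm_mono[of j "Suc j" k x] pre_norm_mono[of j "Suc j" k y] by linarith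
  ultimately show ?case
    using pre_norm_Suc_le_iff[OF c00_add[OF xy] k] by blast
qed

lemma pre_norm_scale_le:
  assumes "x \<in> c00 k"
  shows "pre_norm k d \<theta> j (\<lambda>v. c * x v) \<le> \<bar>c\<bar> * pre_norm k d \<theta> j x"
  using assms
proof (induction j arbitrary: x)
  case 0
  have "\<bar>c * x v\<bar> \<le> \<bar>c\<bar> * pre_norm k d \<theta> 0 x" for v
    using abs_le_pre_norm[OF 0, of v 0] by (simp add: abs_mult mult_left_mono)
  then show ?case
    using pre_norm_0_le_iff[OF c00_scale[OF 0]] by blast
next
  case (Suc j)
  note x = Suc.prems
  have "\<theta> * (\<Sum>i<length Es. pre_norm k d \<theta> j (restr (Es ! i) (\<lambda>v. c * x v))) \<le>
      \<bar>c\<bar> * pre_norm k d \<theta> (Suc j) x"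
    if adm: "admissible k d Es" for Es
  proof -
    have "(\<Sum>i<length Es. pre_norm k d \<theta> j (restr (Es ! i) (\<lambda>v. c * x v))) \<le>
        (\<Sum>i<length Es. \<bar>c\<bar> * pre_norm k d \<theta> j (restr (Es ! i) x))"
      unfolding restr_scale using x by (intro sum_mono Suc.IH c00_restr)
    then have "\<theta> * (\<Sum>i<length Es. pre_norm k d \<theta> j (restr (Es ! i) (\<lambda>v. c * x v))) \<le>
        \<theta> * (\<Sum>i<length Es. \<bar>c\<bar> * pre_norm k d \<theta> j (restr (Es ! i) x))"
      using \<theta> by simp
    also have "\<dots> = \<bar>c\<bar> * (\<theta> * (\<Sum>i<length Es. pre_norm k d \<theta> j (restr (Es ! i) x)))"
      by (simp add: sum_distrib_left mult_ac)
    also have "\<dots> \<le> \<bar>c\<bar> * pre_norm k d \<theta> (Suc j) x"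
      using pre_norm_Suc_le_iff[OF x k, of j] adm by (intro mult_left_mono) auto
    finally show ?thesis .
  qed
  moreover have "pre_norm k d \<theta> j (\<lambda>v. c * x v) \<le> \<bar>c\<bar> * pre_norm k d \<theta> (Suc j) x"
    using Suc.IH[OF x] mult_left_mono[OF pre_norm_mono[of j "Suc j" k x], of "\<bar>c\<bar>"] by linarith
  ultimately show ?case
    using pre_norm_Suc_le_iff[OF c00_scale[OF x] k] by blast
qed

lemma T_norm_le_iff:
  assumes "x \<in> c00 k"
  shows "T_norm k d \<theta> x \<le> c \<longleftrightarrow> (\<forall>j. pre_norm k d \<theta> j x \<le> c)"
  unfolding T_norm_def
  by (subst cSUP_le_iff) (use pre_norm_le_l1[OF assms] in \<open>auto simp: bdd_above_def\<close>)

lemma pre_norm_le_T_norm: "x \<in> c00 k \<Longrightarrow> pre_norm k d \<theta> j x \<le> T_norm k d \<theta> x"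
  using T_norm_le_iff by blast

lemma abs_le_T_norm: "x \<in> c00 k \<Longrightarrow> \<bar>x v\<bar> \<le> T_norm k d \<theta> x"
  using abs_le_pre_norm pre_norm_le_T_norm order_trans by blast

lemma T_norm_nonneg: "x \<in> c00 k \<Longrightarrow> 0 \<le> T_norm k d \<theta> x"
  using abs_le_T_norm by (meson abs_ge_zero order_trans)

lemma T_norm_le_l1: "x \<in> c00 k \<Longrightarrow> T_norm k d \<theta> x \<le> l1 x"
  using T_norm_le_iff pre_norm_le_l1 by blast

lemma T_norm_zero: "T_norm k d \<theta> (\<lambda>v. 0) = 0"
  using T_norm_le_l1[OF c00_zero] T_norm_nonneg[OF c00_zero] by (simp add: l1_def)

lemma T_norm_restr_le: "x \<in> c00 k \<Longrightarrow> T_norm k d \<theta> (restr E x) \<le> T_norm k d \<theta> x"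
  unfolding T_norm_le_iff[OF c00_restr]
  using pre_norm_restr_le pre_norm_le_T_norm order_trans by blast

lemma T_norm_restr_mono:
  assumes "x \<in> c00 k" "E \<inter> supp x \<subseteq> F"
  shows "T_norm k d \<theta> (restr E x) \<le> T_norm k d \<theta> (restr F x)"
proof -
  have "restr E x = restr E (restr F x)"
    using assms(2) by (auto simp: restr_def fun_eq_iff supp_def)
  then show ?thesis using T_norm_restr_le[OF c00_restr[OF assms(1)]] by metis
qed

lemma T_norm_triangle:
  assumes "x \<in> c00 k" "y \<in> c00 k"
  shows "T_norm k d \<theta> (\<lambda>v. x v + y v) \<le> T_norm k d \<theta> x + T_norm k d \<theta> y"
  unfolding T_norm_le_iff[OF c00_add[OF assms]]
  using pre_norm_triangle[OF assms] pre_norm_le_T_norm[OF assms(1)] pre_norm_le_T_norm[OF assms(2)]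
  by (meson add_mono order_trans)

lemma T_norm_scale_le: "x \<in> c00 k \<Longrightarrow> T_norm k d \<theta> (\<lambda>v. c * x v) \<le> \<bar>c\<bar> * T_norm k d \<theta> x"
  unfolding T_norm_le_iff[OF c00_scale]
  using pre_norm_scale_le pre_norm_le_T_norm by (meson abs_ge_zero mult_left_mono order_trans)

lemma T_norm_scale:
  assumes "x \<in> c00 k"
  shows "T_norm k d \<theta> (\<lambda>v. c * x v) = \<bar>c\<bar> * T_norm k d \<theta> x"
proof (cases "c = 0")
  case True
  then show ?thesis by (simp add: T_norm_zero)
next
  case False
  have "T_norm k d \<theta> x = T_norm k d \<theta> (\<lambda>v. inverse c * (c * x v))"
    using False by (simp add: mult.assoc[symmetric])
  also have "\<dots> \<le> \<bar>inverse c\<bar> * T_norm k d \<theta> (\<lambda>v. c * x v)"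
    by (rule T_norm_scale_le[OF c00_scale[OF assms]])
  finally have "\<bar>c\<bar> * T_norm k d \<theta> x \<le> T_norm k d \<theta> (\<lambda>v. c * x v)"
    using False by (simp add: field_simps)
  then show ?thesis using T_norm_scale_le[OF assms, of c] by linarith
qed

lemma T_norm_sum_le:
  assumes "\<And>i. i \<in> I \<Longrightarrow> x i \<in> c00 k"
  shows "T_norm k d \<theta> (\<lambda>v. \<Sum>i\<in>I. x i v) \<le> (\<Sum>i\<in>I. T_norm k d \<theta> (x i))"
  using assms
proof (induction I rule: infinite_finite_induct)
  case (insert i I)
  have "T_norm k d \<theta> (\<lambda>v. \<Sum>i\<in>insert i I. x i v) \<le> T_norm k d \<theta> (x i) + T_norm k d \<theta> (\<lambda>v. \<Sum>i\<in>I. x i v)"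
    using insert by (simp add: T_norm_triangle c00_sum)
  then show ?case using insert by auto
qed (simp_all add: T_norm_zero)

text \<open>The approximating norms increase to \<open>T_norm\<close>, so the inequality between
  stages \<open>j\<close> and \<open>Suc j\<close> survives the limit.\<close>

lemma T_norm_admissible:
  assumes x: "x \<in> c00 k" and adm: "admissible k d Es"
  shows "\<theta> * (\<Sum>i<length Es. T_norm k d \<theta> (restr (Es ! i) x)) \<le> T_norm k d \<theta> x"
proof -
  have lim: "(\<lambda>j. pre_norm k d \<theta> j (restr E x)) \<longlonglongrightarrow> T_norm k d \<theta> (restr E x)" for E
    unfolding T_norm_def
    by (rule LIMSEQ_incseq_SUP)
      (use pre_norm_le_l1[OF c00_restr[OF x], of _ E] in
        \<open>auto simp: bdd_above_def incseq_def intro: pre_norm_mono\<close>)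
  show ?thesis
  proof (rule LIMSEQ_le_const2)
    show "(\<lambda>j. \<theta> * (\<Sum>i<length Es. pre_norm k d \<theta> j (restr (Es ! i) x))) \<longlonglongrightarrow>
        \<theta> * (\<Sum>i<length Es. T_norm k d \<theta> (restr (Es ! i) x))"
      by (intro tendsto_intros lim)
    show "\<exists>N. \<forall>j\<ge>N. \<theta> * (\<Sum>i<length Es. pre_norm k d \<theta> j (restr (Es ! i) x)) \<le> T_norm k d \<theta> x"
      using pre_norm_Suc_le_iff[OF x k] pre_norm_le_T_norm[OF x] adm by blast
  qed
qed

text \<open>Vectors living on different cones \<open>s @ [ix i]\<close> and above the levels \<open>ix i\<close> span an
  isomorphic copy of \<open>\<ell>\<^sub>\<infinity>\<close> with a constant not depending on their number: all but the
  first member of an admissible sequence that meets the support meet only one of these cones.\<close>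

lemma T_norm_sum_cones:
  assumes y: "\<And>i. i \<in> I \<Longrightarrow> y i \<in> c00 k"
    and cone: "\<And>i. i \<in> I \<Longrightarrow> supp (y i) \<subseteq> cone (s @ [ix i])"
    and inj: "inj_on ix I" and fin: "finite I"
    and lev: "\<And>i v. i \<in> I \<Longrightarrow> v \<in> supp (y i) \<Longrightarrow> n \<le> last v"
    and ix: "\<And>i. i \<in> I \<Longrightarrow> ix i < n"
    and one: "\<And>i. i \<in> I \<Longrightarrow> T_norm k d \<theta> (y i) \<le> 1"
  shows "T_norm k d \<theta> (\<lambda>v. \<Sum>i\<in>I. y i v) \<le> real d / (1 - \<theta>)"
proof -
  let ?x = "\<lambda>v. \<Sum>i\<in>I. y i v" and ?B = "real d / (1 - \<theta>)"
  have x: "?x \<in> c00 k" using y by (rule c00_sum)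
  \<comment> \<open>The constant satisfies \<open>?B = \<theta> * ?B + d\<close>. This pays for one
    member of norm up to \<open>?B\<close> together with at most \<open>d\<close> members of norm at
    most 1.\<close>
  have B: "1 \<le> ?B" "\<theta> * (?B + real d) \<le> ?B" "0 \<le> ?B"
  proof -
    have "(1 - \<theta>) * ?B = real d" using \<theta> by simp
    moreover have "\<theta> * real d \<le> real d" using \<theta> by (intro mult_left_le_one_le) auto
    ultimately show "\<theta> * (?B + real d) \<le> ?B"
      unfolding left_diff_distrib distrib_left by linarith
    have "1 - \<theta> \<le> real d" using d \<theta> by linarith
    then show "1 \<le> ?B" using \<theta> by simp
    then show "0 \<le> ?B" by simp
  qed
  \<comment> \<open>A set that meets at most one of the supports sees just that one vector.\<close>
  have single: "pre_norm k d \<theta> j (restr E ?x) \<le> 1"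
    if E: "\<And>i i' v w. i \<in> I \<Longrightarrow> i' \<in> I \<Longrightarrow> v \<in> E \<inter> supp (y i) \<Longrightarrow> w \<in> E \<inter> supp (y i') \<Longrightarrow> i = i'" for E j
  proof (cases "\<exists>i\<in>I. E \<inter> supp (y i) \<noteq> {}")
    case True
    then obtain i v where i: "i \<in> I" "v \<in> E \<inter> supp (y i)" by blast
    have "restr E ?x = restr E (y i)"
    proof
      fix w
      have "(\<Sum>i'\<in>I. y i' w) = y i w" if "w \<in> E"
        using E[OF i(1) _ i(2), of _ w] that i(1) fin
        by (subst sum.remove[of I i]) (auto simp: supp_def intro!: sum.neutral)
      then show "restr E ?x w = restr E (y i) w" by (simp add: restr_def)
    qed
    then show ?thesis
      using pre_norm_restr_le[OF y[OF i(1)], of j E] pre_norm_le_T_norm[OF y[OF i(1)], of j] one[OF i(1)]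
      by simp
  next
    case False
    then have "restr E ?x = (\<lambda>v. 0)"
      by (auto simp: restr_def fun_eq_iff supp_def intro!: sum.neutral)
    then show ?thesis
      using pre_norm_le_T_norm[OF c00_zero, of j] by (simp add: T_norm_zero)
  qed
  have "pre_norm k d \<theta> j ?x \<le> ?B" for j
  proof (induction j)
    case 0
    have "\<bar>?x v\<bar> \<le> 1" if v: "v \<in> ndseq k" for v
    proof -
      have "\<bar>restr {v} ?x v\<bar> \<le> pre_norm k d \<theta> 0 (restr {v} ?x)"
        by (rule abs_le_pre_norm[OF c00_restr[OF x]])
      also have "\<dots> \<le> 1"
      proof (rule single)
        fix i i' u w assume *: "i \<in> I" "i' \<in> I" "u \<in> {v} \<inter> supp (y i)" "w \<in> {v} \<inter> supp (y i')"
        then have "v \<in> cone (s @ [ix i])" "v \<in> cone (s @ [ix i'])" using cone by blast+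
        then have "ix i = ix i'" by (auto simp: cone_def prefix_def)
        then show "i = i'" using inj * by (auto dest: inj_onD)
      qed
      finally show ?thesis by (simp add: restr_def)
    qed
    then show ?case using pre_norm_0_le_iff[OF x] B(1) by fastforce
  next
    case (Suc j)
    have "\<theta> * (\<Sum>i<length Es. pre_norm k d \<theta> j (restr (Es ! i) ?x)) \<le> ?B" if adm: "admissible k d Es" for Es
    proof -
      let ?f = "\<lambda>i. pre_norm k d \<theta> j (restr (Es ! i) ?x)"
      have len: "length Es \<le> d" and AR: "set Es \<subseteq> AR k"
        using adm by (auto simp: admissible_def)
      \<comment> \<open>A member of norm above 1 meets some support and so has a point at level
        \<open>n\<close> or higher. Every later member then starts at level \<open>n\<close> or
        higher, and \<open>AR_unique_cone\<close> confines it to one cone.\<close>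
      have after: "?f i' \<le> 1" if ii': "i < i'" "i' < length Es" "1 < ?f i" for i i'
      proof -
        obtain h v where hv: "h \<in> I" "v \<in> Es ! i" "v \<in> supp (y h)"
          using single[of "Es ! i" j] ii'(3) by (meson IntE not_le)
        have E': "Es ! i' \<in> AR k" using AR ii' by auto
        have "v \<noteq> []" using hv y ndseq_nonempty[OF _ k] by (auto simp: c00_iff)
        then have lev': "n \<le> last w" if "w \<in> Es ! i'" for w
          using admissible_nth_less[OF adm k ii'(1,2) hv(2) that] lev[OF hv(1,3)] seq_less_last_le[of v w]
          by simp
        show ?thesis
        proof (rule single)
          fix i1 i2 u w
          assume i12: "i1 \<in> I" "i2 \<in> I" "u \<in> Es ! i' \<inter> supp (y i1)" "w \<in> Es ! i' \<inter> supp (y i2)"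
          have "ix i1 = ix i2"
          proof (rule AR_unique_cone[OF E' k lev'])
            show "u \<in> cone (s @ [ix i1])" "w \<in> cone (s @ [ix i2])"
              using cone[OF i12(1)] cone[OF i12(2)] i12(3,4) by blast+
          qed (use i12 ix in auto)
          then show "i1 = i2" using inj i12(1,2) by (auto dest: inj_onD)
        qed
      qed
      have le: "?f i \<le> ?B" for i
        using pre_norm_restr_le[OF x, of j "Es ! i"] Suc by linarith
      have "(\<Sum>i<length Es. ?f i) \<le> ?B + real d"
      proof (cases "\<exists>i<length Es. 1 < ?f i")
        case True
        then obtain i where i: "i < length Es" "1 < ?f i" by blast
        have "(\<Sum>i'<length Es. ?f i') = ?f i + (\<Sum>i'\<in>{..<length Es} - {i}. ?f i')"
          using i(1) by (intro sum.remove) auto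
        also have "(\<Sum>i'\<in>{..<length Es} - {i}. ?f i') \<le> real (card ({..<length Es} - {i})) * 1"
        proof (rule sum_bounded_above)
          fix i' assume "i' \<in> {..<length Es} - {i}"
          then show "?f i' \<le> 1"
            using after[of i i'] after[of i' i] i by (metis DiffE insertI1 lessThan_iff linorder_neqE_nat not_le)
        qed
        also have "real (card ({..<length Es} - {i})) * 1 \<le> real d"
          using len i by simp
        finally show ?thesis using le[of i] by simp
      next
        case False
        then have "(\<Sum>i<length Es. ?f i) \<le> real (card {..<length Es}) * 1"
          by (intro sum_bounded_above) force
        then show ?thesis using len B(3) by simp
      qed
      then show ?thesis
        using B(2) \<theta>(1) by (meson less_imp_le mult_left_mono order_trans)
    qed
    then show ?case using pre_norm_Suc_le_iff[OF x k] Suc by blast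
  qed
  then show ?thesis using T_norm_le_iff[OF x] by blast
qed

end
end

section \<open>Lower estimates for successive blocks\<close>

text \<open>Meant for \<open>a\<close> above all entries of \<open>t\<close>: the branch of zeros is
  sent through \<open>t\<close>, and at every other node the last entry is raised by
  \<open>a\<close>. The tree thus stays above level \<open>a\<close> except along
  \<open>t\<close>.\<close>

definition node_val :: "nat list \<Rightarrow> nat \<Rightarrow> nat list \<Rightarrow> nat" where
  "node_val t a s = (if s = replicate (length s) 0 \<and> length s \<le> length t then t ! (length s - 1)
     else last s + a)"

text \<open>The zero sequences of length at most \<open>length t\<close> precede all other nonempty
  nodes and get values below \<open>a\<close>, all others values at least \<open>a\<close>. Within
  the first group sortedness of \<open>t\<close> decides, and a tie there is between a sequence and
  its initial segment; on the rest the map is a shift.\<close>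

lemma E_tree_node_val:
  assumes t: "t \<in> ndseq_le k" "\<And>e. e \<in> set t \<Longrightarrow> e < a"
  shows "E_tree k (tree (node_val t a))"
proof (rule E_tree_tree)
  let ?Z = "\<lambda>s. s = replicate (length s) 0 \<and> length s \<le> length t"
  let ?g = "node_val t a"
  have gZ: "?g s = t ! (length s - 1)" "?g s < a" if "?Z s" "s \<noteq> []" for s
  proof -
    show "?g s = t ! (length s - 1)" using that by (simp add: node_val_def)
    moreover have "t ! (length s - 1) \<in> set t"
      using that by (intro nth_mem) (cases s, auto)
    ultimately show "?g s < a" using t(2) by auto
  qed
  have gN: "?g s = last s + a" if "\<not> ?Z s" for s
    using that by (auto simp: node_val_def)
  have ZZ: "\<exists>m n. s = replicate m 0 \<and> u = replicate n 0 \<and> m < n \<and> n \<le> length t"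
    if "s \<lhd> u" "?Z u" "s \<in> ndseq_le k" "u \<in> ndseq_le k" for s u
  proof -
    have "u \<noteq> []" using that(1) by (auto simp: seq_less_def split: if_splits)
    have "s = [] \<or> last s = 0"
      using seq_less_last_le[OF that(1)] that(2) \<open>u \<noteq> []\<close> by (metis last_replicate le_zero_eq length_0_conv)
    then have s: "s = replicate (length s) 0"
      using sorted_last_zero[of s] that(3) by (auto simp: ndseq_le_def)
    have "length s < length u"
    proof (rule ccontr)
      assume "\<not> length s < length u"
      then have "s = u @ replicate (length s - length u) 0"
        using s that(2) by (metis le_add_diff_inverse not_less replicate_add)
      then have "u = s \<or> strict_prefix u s" by (metis prefixI strict_prefixI)
      then show False
        using strict_prefix_imp_seq_less[of u s] that(1,3) seq_less_asym seq_less_irrefl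
        by (auto simp: ndseq_le_def)
    qed
    then show ?thesis using s that(2) by blast
  qed
  show "?g s \<le> ?g u" if su: "s \<in> ndseq_le k" "u \<in> ndseq_le k" "s \<noteq> []" "s \<lhd> u" for s u
  proof (cases "?Z u")
    case True
    then obtain m n where mn: "s = replicate m 0" "u = replicate n 0" "m < n" "n \<le> length t"
      using ZZ[OF su(4) True su(1,2)] by blast
    then have "m \<noteq> 0" using su(3) by auto
    then have "t ! (m - 1) \<le> t ! (n - 1)"
      using mn t(1) by (auto simp: ndseq_le_def sorted_iff_nth_mono)
    then show ?thesis using mn by (simp add: node_val_def)
  next
    case False
    show ?thesis
    proof (cases "?Z s")
      case True
      then show ?thesis using gZ(2)[OF True su(3)] gN[OF False] by simp
    next
      case False': False
      then show ?thesis using gN[OF False] gN[OF False'] seq_less_last_le[OF su(4,3)] by simp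
    qed
  qed
  show "?g (s @ [b]) < ?g (s @ [c])" if "s @ [b] \<in> ndseq_le k" "b < c" for s b c
  proof -
    have "\<not> ?Z (s @ [c])"
      using that(2) by (metis last_replicate last_snoc length_append_singleton nat.distinct(1) not_less_zero
        replicate_empty)
    then have "?g (s @ [c]) = c + a" using gN by simp
    moreover have "?g (s @ [b]) \<le> b + a"
      using gZ(2)[of "s @ [b]"] gN[of "s @ [b]"] by (cases "?Z (s @ [b])") auto
    ultimately show ?thesis using that(2) by simp
  qed
  show "(s, u) \<in> lex_less"
    if su: "s \<in> ndseq_le k" "u \<in> ndseq_le k" "s \<noteq> []" "s \<lhd> u" "?g s = ?g u" for s u
  proof (cases "?Z u")
    case True
    then obtain m n where mn: "s = replicate m 0" "u = replicate n 0" "m < n"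
      using ZZ[OF su(4) True su(1,2)] by blast
    then have "u = s @ replicate (n - m) 0"
      by (metis le_add_diff_inverse less_imp_le replicate_add)
    then show ?thesis
      using mn by (cases "n - m") (auto intro: lexord_append_rightI)
  next
    case False
    then have "\<not> ?Z s" using gZ(2)[of s] gN[of u] su(3,5) by fastforce
    then have "last s = last u" using gN[OF False] gN su(5) by simp
    then show ?thesis using su(3,4) by (auto simp: seq_less_def)
  qed
qed

text \<open>For \<open>length t < k\<close> the index \<open>length t\<close> is that of the first
  entry after \<open>t\<close>; as leaves are sorted, all entries after \<open>t\<close> then lie in
  \<open>{m<..l}\<close>.\<close>

definition band :: "nat \<Rightarrow> nat list \<Rightarrow> nat \<Rightarrow> nat \<Rightarrow> nat list set" where
  "band k t m l = {v \<in> ndseq k. prefix t v \<and> m < v ! length t \<and> last v \<le> l}"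

text \<open>A member of \<^term>\<open>AR k\<close> can contain a whole band above the node \<open>t\<close> although it
  starts only after level \<open>m\<close>: it is the image of an initial segment under a tree that sends the
  leftmost branch through \<open>t\<close>.\<close>

lemma AR_band:
  assumes t: "t \<in> ndseq_le k" "length t < k" "\<And>e. e \<in> set t \<Longrightarrow> e \<le> m" and ml: "m < l"
  shows "\<exists>E\<in>AR k. band k t m l \<subseteq> E \<and> (\<forall>v\<in>E. m < last v \<and> last v \<le> l)"
proof -
  \<comment> \<open>Raising by \<open>Suc m\<close> carries the levels
    \<open>0, ..., l - Suc m\<close> onto \<open>Suc m, ..., l\<close>.\<close>
  let ?a = "Suc m" and ?I = "{s \<in> ndseq k. last s \<le> l - Suc m}"
  let ?X = "tree (node_val t ?a)"
  have k: "1 \<le> k" using t(2) by simp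
  have X: "E_tree k ?X"
    using t(3) by (intro E_tree_node_val t(1)) (simp add: less_Suc_eq_le)
  have "replicate k 0 \<in> ?I"
    using zero_ndseq k by simp
  moreover have "finite ?I"
    by (rule finite_subset[OF _ finite_bounded_ndseq[of k "l - Suc m"]])
      (use ndseq_subset ndseq_le_set_last in blast)
  ultimately have card: "1 \<le> card ?I"
    by (metis One_nat_def Suc_leI card_gt_0_iff empty_iff)
  have E: "?X ` ?I \<in> AR k"
    unfolding AR_iff using X card arg_cong[OF idx_initial[OF k, of "l - Suc m"], of "image ?X"] by blast
  have lastX: "last (?X s) = last s + ?a" if "s \<in> ndseq k" for s
  proof -
    have "\<not> length s \<le> length t" "s \<noteq> []" using that t(2) by (auto simp: ndseq_def)
    then show ?thesis by (simp add: last_tree node_val_def)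
  qed
  have "v \<in> ?X ` ?I" if v: "v \<in> band k t m l" for v
  proof
    \<comment> \<open>The preimage of \<open>v\<close>: zeros in place of \<open>t\<close>, the
      other entries lowered by the shift.\<close>
    define s where "s = replicate (length t) 0 @ map (\<lambda>e. e - ?a) (drop (length t) v)"
    obtain w where w: "v = t @ w" using v by (auto simp: band_def prefix_def)
    have len: "length v = k" "sorted v" using v by (auto simp: band_def ndseq_def)
    have sorted_w: "sorted w" using len(2) by (simp add: w sorted_append)
    have w_ge: "?a \<le> e" if "e \<in> set w" for e
    proof -
      obtain i where i: "i < length w" "e = w ! i" using \<open>e \<in> set w\<close> by (auto simp: in_set_conv_nth)
      have "w ! 0 \<le> w ! i" using sorted_w i(1) by (simp add: sorted_nth_mono)
      then show ?thesis using v i by (auto simp: band_def w nth_append)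
    qed
    have wne: "w \<noteq> []" using len(1) t(2) by (auto simp: w)
    have "sorted (map (\<lambda>e. e - ?a) w)"
      using sorted_w by (auto simp: sorted_iff_nth_mono diff_le_mono)
    then have s: "s \<in> ndseq k"
      using len by (auto simp: s_def ndseq_def w sorted_append)
    have "last s = last w - ?a" using wne by (simp add: s_def w last_map)
    then show "s \<in> ?I" using v s wne by (auto simp: band_def w)
    show "v = ?X s"
    proof (rule nth_equalityI)
      show "length v = length (?X s)" using s len by (simp add: ndseq_def)
      fix i assume i: "i < length v"
      then have i_s: "i < length s" using s len by (simp add: ndseq_def)
      show "v ! i = ?X s ! i"
      proof (cases "i < length t")
        case True
        then have "take (Suc i) s = replicate (Suc i) 0" by (simp add: s_def)
        then show ?thesis using True i_s by (simp add: nth_tree node_val_def w nth_append)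
      next
        case False
        have "last (take (Suc i) s) = s ! i"
          using i_s by (simp add: take_Suc_conv_app_nth)
        also have "\<dots> = w ! (i - length t) - ?a"
          using False i by (simp add: s_def w nth_append)
        finally have "last (take (Suc i) s) = w ! (i - length t) - ?a" .
        moreover have "?a \<le> w ! (i - length t)"
          using w_ge False i by (intro w_ge nth_mem) (auto simp: w)
        ultimately show ?thesis using False i_s by (simp add: nth_tree node_val_def w nth_append)
      qed
    qed
  qed
  moreover have "m < last v \<and> last v \<le> l" if "v \<in> ?X ` ?I" for v
    using that lastX ml by auto
  ultimately show ?thesis using E by blast
qed

text \<open>Adding \<open>rank\<close> makes the values strictly increasing, so ties never occur,
  while \<open>L\<close> remains a free choice of levels: the leaf of index \<open>i\<close> ends at
  \<open>L i\<close> plus its rank.\<close>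

lemma E_tree_idx_rank:
  assumes L: "mono L"
  shows "E_tree k (tree (\<lambda>s. L (idx k s) + rank k s))"
proof (rule E_tree_tree)
  let ?g = "\<lambda>s. L (idx k s) + rank k s"
  have strict: "?g s < ?g t" if "s \<in> ndseq_le k" "s \<lhd> t" for s t
    using monoD[OF L idx_mono[OF that(2)]] rank_strict_mono[OF that(2,1)] by (meson add_le_less_mono)
  show "?g s \<le> ?g t" if "s \<in> ndseq_le k" "s \<lhd> t" for s t
    using strict[OF that] by simp
  show "(s, t) \<in> lex_less" if "s \<in> ndseq_le k" "s \<lhd> t" "?g s = ?g t" for s t
    using strict[OF that(1,2)] that(3) by simp
  show "?g (s @ [a]) < ?g (s @ [b])" if "s @ [a] \<in> ndseq_le k" "a < b" for s a b
    by (rule strict[OF that(1)], rule last_less_imp_seq_less) (use that in auto)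
qed

text \<open>The number of nodes that precede one of the first \<open>d\<close> leaves bounds how much room the
  markers \<open>v\<^sub>1, \<dots>, v\<^sub>d\<close> of an admissible sequence need between consecutive blocks.\<close>

definition gap :: "nat \<Rightarrow> nat \<Rightarrow> nat" where
  "gap k d = Suc (Max (rank k ` {s \<in> ndseq k. idx k s < d}))"

lemma finite_idx_less:
  assumes "1 \<le> k"
  shows "finite {s \<in> ndseq k. idx k s < d}"
proof -
  obtain t where t: "t \<in> ndseq k" "idx k t = d"
    using idx_surj[OF assms] by blast
  have "{s \<in> ndseq k. idx k s < d} \<subseteq> {s \<in> ndseq k. s \<lhd> t}"
    using t idx_mono seq_less_total by (metis (mono_tags, lifting) Collect_mono leD order_refl)
  then show ?thesis using finite_predecessors' finite_subset by blast
qed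

text \<open>The markers are the first \<open>m\<close> leaves of the tree from
  \<open>E_tree_idx_rank\<close>. Marker \<open>i\<close> ends at \<open>L i\<close> plus a rank
  that is positive and less than \<open>gap k d\<close>, hence after block \<open>i - 1\<close> and
  before block \<open>i\<close>.\<close>

lemma admissible_markers:
  assumes k: "1 \<le> k" and m: "length Es = m" "1 \<le> m" "m \<le> d" and AR: "set Es \<subseteq> AR k"
    and lev: "\<And>i v. i < m \<Longrightarrow> v \<in> Es ! i \<Longrightarrow> L i + gap k d < last v"
    and lev': "\<And>i v. Suc i < m \<Longrightarrow> v \<in> Es ! i \<Longrightarrow> last v \<le> L (Suc i)"
    and L: "mono L"
  shows "admissible k d Es"
proof -
  let ?X = "tree (\<lambda>s. L (idx k s) + rank k s)"
  have X: "E_tree k ?X" using L by (rule E_tree_idx_rank)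
  obtain s where s: "\<And>i. s i \<in> ndseq k" "\<And>i. idx k (s i) = i"
    using idx_surj[OF k] by metis
  let ?vs = "map (\<lambda>i. ?X (s i)) [0..<m]"
  have "set ?vs = ?X ` {u \<in> ndseq k. idx k u < m}"
  proof -
    have "s ` {0..<m} = {u \<in> ndseq k. idx k u < m}"
    proof
      show "{u \<in> ndseq k. idx k u < m} \<subseteq> s ` {0..<m}"
      proof safe
        fix u assume "u \<in> ndseq k" "idx k u < m"
        then show "u \<in> s ` {0..<m}"
          using s inj_onD[OF idx_inj[of k], of u "s (idx k u)"] by (intro image_eqI[of _ _ "idx k u"]) auto
      qed
    qed (use s in auto)
    then show ?thesis by (metis image_image image_set set_upt list.set_map)
  qed
  then have "set ?vs \<in> AR_n k m"
    using X AR_n_iff by blast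
  then have A: "set ?vs \<in> A_fam k d"
    using m by (auto simp: A_fam_def)
  have sne: "s i \<noteq> []" for i using s ndseq_nonempty[OF _ k] by blast
  have lastv: "last (?X (s i)) = L i + rank k (s i)" for i
    using sne s by (simp add: last_tree)
  have rank_pos: "0 < rank k (s i)" for i
    using rank_strict_mono[of "[]" "s i" k] sne by (fastforce simp: seq_less_def ndseq_le_def)
  have rank_less: "rank k (s i) < gap k d" if "i < m" for i
    unfolding gap_def using finite_idx_less[OF k, of d] s that m(3)
    by (intro le_imp_less_Suc Max_ge) auto
  have ne: "v \<noteq> []" if "v \<in> Es ! i" "i < m" for v i
    using that AR AR_subset ndseq_nonempty[OF _ k] m(1) by (metis nth_mem subsetD)
  have "?X (s i) \<lhd> v" if "i < m" "v \<in> Es ! i" for i v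
    using lev[OF that] rank_less[OF that(1)] lastv[of i] ne[OF that(2,1)] sne
    by (intro last_less_imp_seq_less) auto
  moreover have "v \<lhd> ?X (s (Suc i))" if "Suc i < m" "v \<in> Es ! i" for i v
    using lev'[OF that] rank_pos[of "Suc i"] lastv[of "Suc i"] ne[OF that(2)] that(1) sne
    by (intro last_less_imp_seq_less) auto
  ultimately show ?thesis
    unfolding admissible_def block_le_def block_less_def
    using m AR A by (intro conjI exI[of _ ?vs]) auto
qed

context
  fixes d :: nat and \<theta> :: real
  assumes d: "1 \<le> d" and \<theta>: "0 < \<theta>" "\<theta> < 1"
begin

text \<open>Split the \<open>d ^ Suc r\<close> bands into \<open>d\<close> consecutive groups of
  \<open>d ^ r\<close>. By \<open>AR_band\<close> each group fits into one member of
  \<open>AR k\<close>, and the gaps leave room for markers, so these \<open>d\<close> members are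
  admissible. Each induction step gains a factor \<open>\<theta> * d\<close>.\<close>

lemma T_norm_bands:
  assumes t: "t \<in> ndseq_le k" "length t < k"
    and x: "x \<in> c00 k" and a: "0 \<le> a"
    and ml: "\<And>j. j < d ^ r \<Longrightarrow> m j < l j"
    and lm: "\<And>j. Suc j < d ^ r \<Longrightarrow> l j + gap k d \<le> m (Suc j)"
    and m0: "gap k d \<le> m 0" "\<And>e. e \<in> set t \<Longrightarrow> e \<le> m 0"
    and large: "\<And>j. j < d ^ r \<Longrightarrow> a \<le> T_norm k d \<theta> (restr (band k t (m j) (l j)) x)"
  shows "(\<theta> * real d) ^ r * a \<le> T_norm k d \<theta> x"
  using x ml lm m0 large
proof (induction r arbitrary: m l x)
  case 0
  have "1 \<le> k" using t(2) by simp
  then show ?case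
    using 0(6)[of 0] T_norm_restr_le[OF d \<theta> _ 0(1), of "band k t (m 0) (l 0)"] by simp
next
  case (Suc r)
  have k: "1 \<le> k" using t(2) by simp
  note x = Suc.prems(1) and ml = Suc.prems(2) and lm = Suc.prems(3) and m0 = Suc.prems(4,5)
    and large = Suc.prems(6)
  define q where "q = d ^ r"
  have q: "1 \<le> q" using d by (simp add: q_def)
  have n: "d ^ Suc r = d * q" by (simp add: q_def)
  have mm: "m i \<le> m j" if "i \<le> j" "j < d * q" for i j
    using that
  proof (induction j)
    case (Suc j)
    then show ?case using lm[of j] ml[of j] n by (cases "i = Suc j") (auto simp: q_def)
  qed simp
  have lm': "l i + gap k d \<le> m j" if "i < j" "j < d * q" for i j
    using lm[of i] mm[of "Suc i" j] that n by auto
  have ll: "l i \<le> l j" if "i \<le> j" "j < d * q" for i j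
    using lm'[of i j] ml[of j] that n by (cases "i = j") auto
  have blk: "i * q + j < d * q" if "i < d" "j < q" for i j
  proof -
    have "i * q + j < Suc i * q" using that by simp
    also have "\<dots> \<le> d * q" using that by (intro mult_le_mono1) simp
    finally show ?thesis .
  qed
  have "\<exists>E\<in>AR k. band k t (m (i * q)) (l (i * q + (q - 1))) \<subseteq> E \<and>
      (\<forall>v\<in>E. m (i * q) < last v \<and> last v \<le> l (i * q + (q - 1)))" if i: "i < d" for i
  proof (rule AR_band[OF t])
    show "m (i * q) < l (i * q + (q - 1))"
      using ml[of "i * q"] ll[of "i * q" "i * q + (q - 1)"] blk[OF i, of 0] blk[OF i, of "q - 1"] q n
      by fastforce
    show "e \<le> m (i * q)" if "e \<in> set t" for e
      using m0(2)[OF that] mm[of 0 "i * q"] blk[OF i, of 0] q by simp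
  qed
  then obtain E where E: "\<And>i. i < d \<Longrightarrow> E i \<in> AR k"
      "\<And>i. i < d \<Longrightarrow> band k t (m (i * q)) (l (i * q + (q - 1))) \<subseteq> E i"
      "\<And>i v. i < d \<Longrightarrow> v \<in> E i \<Longrightarrow> m (i * q) < last v \<and> last v \<le> l (i * q + (q - 1))"
    by metis
  let ?Es = "map E [0..<d]"
  \<comment> \<open>The top level of the group before block \<open>i\<close>. At 0 the value 0
    suffices, since \<open>gap k d \<le> m 0\<close> already leaves room for the first marker; the
    minimum with \<open>d\<close> keeps \<open>L\<close> monotone past the last group.\<close>
  define L where "L i = (if i = 0 then 0 else l (min i d * q - 1))" for i
  have L_Suc: "L (Suc i) = l (i * q + (q - 1))" if "i < d" for i
    using that q by (simp add: L_def min_def add.commute)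
  have adm: "admissible k d ?Es"
  proof (rule admissible_markers[OF k])
    show "set ?Es \<subseteq> AR k" using E(1) by auto
    show "L i + gap k d < last v" if "i < d" "v \<in> ?Es ! i" for i v
    proof (cases i)
      case 0
      then show ?thesis using E(3)[of i v] that m0(1) by (simp add: L_def)
    next
      case (Suc i')
      then have "L i + gap k d \<le> m (i * q)"
        using L_Suc[of i'] lm'[of "i' * q + (q - 1)" "i * q"] blk[of i 0] q that(1) by auto
      then show ?thesis using E(3)[of i v] that by simp
    qed
    show "last v \<le> L (Suc i)" if "Suc i < d" "v \<in> ?Es ! i" for i v
      using E(3)[of i v] that L_Suc[of i] by simp
    show "mono L"
    proof (rule monoI)
      fix i j :: nat assume "i \<le> j"
      show "L i \<le> L j"
      proof (cases "i = 0")
        case False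
        have "min j d * q \<le> d * q" "min i d * q \<le> min j d * q"
          using \<open>i \<le> j\<close> by (intro mult_le_mono1; simp)+
        moreover have "1 \<le> min j d * q" using \<open>i \<le> j\<close> False q d by simp
        ultimately have "l (min i d * q - 1) \<le> l (min j d * q - 1)" by (intro ll) linarith+
        then show ?thesis using False \<open>i \<le> j\<close> by (simp add: L_def)
      qed (simp add: L_def)
    qed
  qed (use d in auto)
  have "(\<theta> * real d) ^ r * a \<le> T_norm k d \<theta> (restr (E i) x)" if i: "i < d" for i
  proof (rule Suc.IH[where m = "\<lambda>j. m (i * q + j)" and l = "\<lambda>j. l (i * q + j)"])
    show "restr (E i) x \<in> c00 k" by (rule c00_restr[OF x])
    show "m (i * q + j) < l (i * q + j)" if "j < d ^ r" for j
      using ml blk[OF i, of j] that n by (simp add: q_def)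
    show "l (i * q + j) + gap k d \<le> m (i * q + Suc j)" if "Suc j < d ^ r" for j
      using lm[of "i * q + j"] blk[OF i, of "Suc j"] that n by (simp add: q_def)
    have m_le: "m 0 \<le> m (i * q)" using mm[of 0 "i * q"] blk[OF i, of 0] q by simp
    then show "gap k d \<le> m (i * q + 0)" "\<And>e. e \<in> set t \<Longrightarrow> e \<le> m (i * q + 0)"
      using m0 by (auto intro: order_trans)
    show "a \<le> T_norm k d \<theta> (restr (band k t (m (i * q + j)) (l (i * q + j))) (restr (E i) x))"
      if "j < d ^ r" for j
    proof -
      have j: "j < q" using that by (simp add: q_def)
      have "m (i * q) \<le> m (i * q + j)" "l (i * q + j) \<le> l (i * q + (q - 1))"
        using mm[of "i * q" "i * q + j"] ll[of "i * q + j" "i * q + (q - 1)"]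
          blk[OF i, of j] blk[OF i, of "q - 1"] j by auto
      then have "band k t (m (i * q + j)) (l (i * q + j)) \<subseteq> band k t (m (i * q)) (l (i * q + (q - 1)))"
        by (auto simp: band_def)
      then have "band k t (m (i * q + j)) (l (i * q + j)) \<inter> E i = band k t (m (i * q + j)) (l (i * q + j))"
        using E(2)[OF i] by blast
      then show ?thesis
        using large[of "i * q + j"] blk[OF i j] by (simp add: restr_restr q_def)
    qed
  qed
  then have "(\<Sum>i<d. (\<theta> * real d) ^ r * a) \<le> (\<Sum>i<d. T_norm k d \<theta> (restr (E i) x))"
    by (intro sum_mono) auto
  then have "\<theta> * (real d * ((\<theta> * real d) ^ r * a)) \<le> \<theta> * (\<Sum>i<d. T_norm k d \<theta> (restr (E i) x))"
    using \<theta> by simp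
  also have "\<dots> \<le> T_norm k d \<theta> x"
    using T_norm_admissible[OF d \<theta> k x adm] by simp
  finally show ?case by (simp add: mult_ac)
qed

end

section \<open>Operators between spaces of different depth\<close>

lemma l1_le_sum:
  assumes "finite S" "supp x \<subseteq> S"
  shows "l1 x \<le> (\<Sum>v\<in>S. \<bar>x v\<bar>)"
  unfolding l1_def using assms by (intro sum_mono2) auto

definition unit :: "'i \<Rightarrow> 'i \<Rightarrow> real" where
  "unit v = (\<lambda>w. if w = v then 1 else 0)"

lemma supp_unit: "supp (unit v) = {v}"
  by (auto simp: supp_def unit_def)

lemma unit_c00: "v \<in> ndseq k \<Longrightarrow> unit v \<in> c00 k"
  by (simp add: c00_iff supp_unit)

lemma l1_unit: "l1 (unit v) = 1"
  by (simp add: l1_def supp_unit) (simp add: unit_def)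

definition cones :: "nat list set \<Rightarrow> nat list set" where
  "cones F = (\<Union>t\<in>F. cone t)"

context
  fixes d :: nat and \<theta> :: real
  assumes d: "1 \<le> d" and \<theta>: "0 < \<theta>" "\<theta> < 1"
begin

lemma T_norm_add_lower:
  assumes "1 \<le> k" "x \<in> c00 k" "y \<in> c00 k"
  shows "T_norm k d \<theta> x \<le> T_norm k d \<theta> (\<lambda>v. x v + y v) + T_norm k d \<theta> y"
  using T_norm_triangle[OF d \<theta> assms(1) c00_add[OF assms(2,3)] c00_scale[OF assms(3), of "-1"]]
    T_norm_scale[OF d \<theta> assms(1,3), of "-1"] by simp

lemma T_norm_restr_Un:
  assumes "1 \<le> k" "x \<in> c00 k"
  shows "T_norm k d \<theta> (restr (A \<union> B) x) \<le> T_norm k d \<theta> (restr A x) + T_norm k d \<theta> (restr B x)"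
proof -
  have "restr (A \<union> B) x = (\<lambda>v. restr A x v + restr (B - A) x v)"
    by (auto simp: restr_def)
  then have "T_norm k d \<theta> (restr (A \<union> B) x) \<le> T_norm k d \<theta> (restr A x) + T_norm k d \<theta> (restr (B - A) x)"
    using T_norm_triangle[OF d \<theta> assms(1) c00_restr[OF assms(2)] c00_restr[OF assms(2)]] by metis
  moreover have "T_norm k d \<theta> (restr (B - A) x) \<le> T_norm k d \<theta> (restr B x)"
    using T_norm_restr_mono[OF d \<theta> assms] by blast
  ultimately show ?thesis by linarith
qed

lemma T_norm_restr_UN:
  assumes "1 \<le> k" "x \<in> c00 k" "finite F"
  shows "T_norm k d \<theta> (restr (\<Union>t\<in>F. A t) x) \<le> (\<Sum>t\<in>F. T_norm k d \<theta> (restr (A t) x))"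
  using assms(3)
proof (induction F)
  case empty
  then show ?case by (simp add: restr_def T_norm_zero[OF d \<theta> assms(1)])
next
  case (insert t F)
  then show ?case using T_norm_restr_Un[OF assms(1,2), of "A t" "\<Union>t\<in>F. A t"] by simp
qed

section \<open>Bounded operators from depth \<open>K\<close> to depth \<open>k\<close>\<close>

context
  fixes k K :: nat and \<Psi> :: "(nat list \<Rightarrow> real) \<Rightarrow> nat list \<Rightarrow> real" and C :: real
  assumes k: "1 \<le> k" and K: "1 \<le> K"
    and \<Psi>_in: "\<And>x. x \<in> c00 K \<Longrightarrow> \<Psi> x \<in> c00 k"
    and \<Psi>_add: "\<And>x y. x \<in> c00 K \<Longrightarrow> y \<in> c00 K \<Longrightarrow> \<Psi> (\<lambda>v. x v + y v) = (\<lambda>w. \<Psi> x w + \<Psi> y w)"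
    and \<Psi>_scale: "\<And>c x. x \<in> c00 K \<Longrightarrow> \<Psi> (\<lambda>v. c * x v) = (\<lambda>w. c * \<Psi> x w)"
    and \<Psi>_bound: "\<And>x. x \<in> c00 K \<Longrightarrow> T_norm k d \<theta> (\<Psi> x) \<le> C * T_norm K d \<theta> x"
    and C: "0 \<le> C"
begin

lemma Psi_zero: "\<Psi> (\<lambda>v. 0) = (\<lambda>w. 0)"
  using \<Psi>_scale[OF c00_zero, of 0] by simp

lemma Psi_sum:
  assumes "finite I" "\<And>i. i \<in> I \<Longrightarrow> x i \<in> c00 K"
  shows "\<Psi> (\<lambda>v. \<Sum>i\<in>I. x i v) = (\<lambda>w. \<Sum>i\<in>I. \<Psi> (x i) w)"
  using assms by (induction I) (simp_all add: Psi_zero \<Psi>_add c00_sum)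

text \<open>Above the node \<open>s\<close> and arbitrarily far out, \<open>\<Psi>\<close> is not bounded below modulo finitely many
  cones whose nodes leave \<open>l\<close> more entries, provided that \<open>s\<close> leaves more than \<open>l\<close>.\<close>

definition escapes :: "nat \<Rightarrow> bool" where
  "escapes l \<longleftrightarrow> (\<forall>s F \<epsilon> N. s \<in> ndseq_le K \<longrightarrow> length s + l < K \<longrightarrow> finite F \<longrightarrow>
     F \<subseteq> {t \<in> ndseq_le k. length t + l = k} \<longrightarrow> 0 < \<epsilon> \<longrightarrow>
     (\<exists>y\<in>c00 K. supp y \<subseteq> cone s \<inter> {v. N < last v} \<and>
        T_norm k d \<theta> (restr (cones F) (\<Psi> y)) < \<epsilon> * T_norm K d \<theta> y))"

text \<open>Here \<open>F\<close> consists of leaves, so only finitely many coordinates matter, and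
  on unit vectors the images have coordinates bounded by \<open>C\<close>. Among infinitely many
  leaves above \<open>s\<close>, two have images that nearly agree on \<open>F\<close>; the
  difference of their unit vectors has norm at least 1 and does the job.\<close>

lemma escapes_0: "escapes 0"
  unfolding escapes_def
proof (intro allI impI)
  fix s F \<epsilon> and N :: nat
  assume s: "s \<in> ndseq_le K" "length s + 0 < K" and F: "finite F"
    "F \<subseteq> {t \<in> ndseq_le k. length t + 0 = k}" and \<epsilon>: "0 < (\<epsilon>::real)"
  define leaf where "leaf c = s @ replicate (K - length s) c" for c
  define \<delta> where "\<delta> = \<epsilon> / real (Suc (card F))"
  have \<delta>: "0 < \<delta>" using \<epsilon> by (simp add: \<delta>_def)
  obtain c0 where c0: "\<And>e. e \<in> set s \<Longrightarrow> e \<le> c0"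
    using finite_nat_set_iff_bounded_le[of "set s"] by auto
  let ?A = "{max c0 (Suc N)..}"
  have leaf: "leaf c \<in> ndseq K" "leaf c \<in> cone s" "N < last (leaf c)" if "c \<in> ?A" for c
    using that s c0 by (auto simp: leaf_def ndseq_def ndseq_le_def sorted_append cone_def
        sorted_replicate intro: order_trans)
  have leaf_inj: "leaf c \<noteq> leaf c'" if "c \<noteq> c'" for c c'
    using that s(2) by (auto simp: leaf_def)
  let ?z = "\<lambda>c. \<Psi> (unit (leaf c))"
  have z: "?z c \<in> c00 k" if "c \<in> ?A" for c
    using \<Psi>_in unit_c00 leaf(1)[OF that] by blast
  have z_le: "\<bar>?z c t\<bar> \<le> C" if "c \<in> ?A" for c t
  proof -
    have "\<bar>?z c t\<bar> \<le> T_norm k d \<theta> (?z c)" by (rule abs_le_T_norm[OF d \<theta> k z[OF that]])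
    also have "\<dots> \<le> C * T_norm K d \<theta> (unit (leaf c))" using \<Psi>_bound unit_c00 leaf(1)[OF that] by blast
    also have "\<dots> \<le> C * 1"
      using T_norm_le_l1[OF d \<theta> K unit_c00[OF leaf(1)[OF that]]] C by (intro mult_left_mono) (auto simp: l1_unit)
    finally show ?thesis by simp
  qed
  \<comment> \<open>Rounding the coordinates on \<open>F\<close> to multiples of
    \<open>\<delta>\<close> leaves finitely many patterns.\<close>
  define f where "f c = restrict (\<lambda>t. \<lfloor>?z c t / \<delta>\<rfloor>) F" for c
  have "f ` ?A \<subseteq> F \<rightarrow>\<^sub>E {\<lfloor>- C / \<delta>\<rfloor>..\<lfloor>C / \<delta>\<rfloor>}"
  proof -
    have "\<lfloor>?z c t / \<delta>\<rfloor> \<in> {\<lfloor>- C / \<delta>\<rfloor>..\<lfloor>C / \<delta>\<rfloor>}" if "c \<in> ?A" for c t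
    proof -
      have "- C / \<delta> \<le> ?z c t / \<delta>" "?z c t / \<delta> \<le> C / \<delta>"
        using z_le[OF that, of t] \<delta> by (intro divide_right_mono; simp)+
      then show ?thesis by (simp only: atLeastAtMost_iff floor_mono)
    qed
    then show ?thesis unfolding f_def by auto
  qed
  then have "finite (f ` ?A)"
    by (rule finite_subset) (simp add: F(1) finite_PiE)
  then obtain c where "c \<in> ?A" "infinite {a \<in> ?A. f a = f c}"
    using pigeonhole_infinite[of ?A f] infinite_Ici by blast
  moreover from this obtain c' where "c' \<in> {a \<in> ?A. f a = f c}" "c' \<noteq> c"
    using finite_subset[of "{a \<in> ?A. f a = f c}" "{c}"] by blast
  ultimately have c: "c \<in> ?A" "c' \<in> ?A" "f c = f c'" "c \<noteq> c'" by auto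
  let ?y = "\<lambda>v. unit (leaf c) v + -1 * unit (leaf c') v"
  have u: "unit (leaf c) \<in> c00 K" "unit (leaf c') \<in> c00 K" using leaf(1) c unit_c00 by auto
  have y: "?y \<in> c00 K" by (intro c00_add c00_scale u)
  have \<Psi>y: "\<Psi> ?y = (\<lambda>w. ?z c w + -1 * ?z c' w)"
    using \<Psi>_add[OF u(1) c00_scale[OF u(2)], of "-1"] \<Psi>_scale[OF u(2), of "-1"] by simp
  have small: "\<bar>\<Psi> ?y t\<bar> < \<delta>" if "t \<in> F" for t
  proof -
    have "\<lfloor>?z c t / \<delta>\<rfloor> = \<lfloor>?z c' t / \<delta>\<rfloor>" using fun_cong[OF c(3), of t] that by (simp add: f_def)
    then have "\<bar>?z c t / \<delta> - ?z c' t / \<delta>\<bar> < 1" by linarith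
    then show ?thesis unfolding \<Psi>y using \<delta> by (simp add: field_simps abs_less_iff)
  qed
  let ?r = "restr (cones F) (\<Psi> ?y)"
  have r: "?r \<in> c00 k" using \<Psi>_in[OF y] by (rule c00_restr)
  have "T_norm k d \<theta> ?r \<le> l1 ?r" by (rule T_norm_le_l1[OF d \<theta> k r])
  also have "\<dots> \<le> (\<Sum>t\<in>F. \<bar>?r t\<bar>)"
  proof (rule l1_le_sum[OF F(1)], rule subsetI)
    fix v assume "v \<in> supp ?r"
    then have "v \<in> ndseq k" "v \<in> cones F"
      using r by (auto simp: c00_iff, auto simp: supp_def restr_def split: if_splits)
    then obtain t u where t: "t \<in> F" "v = t @ u" "length v = k"
      by (auto simp: cones_def cone_def ndseq_def prefix_def)
    then have "u = []" using F(2) by auto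
    then show "v \<in> F" using t by simp
  qed
  also have "\<dots> \<le> real (card F) * \<delta>"
    using small by (intro sum_bounded_above) (force simp: restr_def)
  also have "\<dots> < \<epsilon>" using \<epsilon> by (simp add: \<delta>_def field_simps)
  also have "\<epsilon> \<le> \<epsilon> * T_norm K d \<theta> ?y"
    using abs_le_T_norm[OF d \<theta> K y, of "leaf c"] leaf_inj[OF c(4)] \<epsilon> by (simp add: unit_def)
  finally show "\<exists>y\<in>c00 K. supp y \<subseteq> cone s \<inter> {v. N < last v} \<and>
      T_norm k d \<theta> (restr (cones F) (\<Psi> y)) < \<epsilon> * T_norm K d \<theta> y"
    using y leaf(2,3) c(1,2) by (intro bexI[of _ ?y]) (auto simp: supp_def unit_def split: if_splits)
qed

text \<open>If every vector far out above \<open>s\<close> kept a share \<open>\<epsilon>\<close> of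
  its norm on \<open>cones F\<close>, vectors above distinct children of \<open>s\<close> could be
  chosen one by one, each image being small on the children of \<open>F\<close> up to a level past
  all earlier images. Their shares then fall into successive bands; for the vectors assigned to one
  node of \<open>F\<close>, \<open>T_norm_bands\<close> contradicts
  \<open>T_norm_sum_cones\<close>.\<close>

lemma escapes_Suc:
  assumes esc: "escapes l" and l: "Suc l \<le> k" and growth: "1 < \<theta> * real d"
  shows "escapes (Suc l)"
  unfolding escapes_def
proof (intro allI impI, rule ccontr)
  fix s F \<epsilon> and N :: nat
  assume s: "s \<in> ndseq_le K" "length s + Suc l < K" and F: "finite F"
    "F \<subseteq> {t \<in> ndseq_le k. length t + Suc l = k}" and \<epsilon>: "0 < (\<epsilon>::real)"
    and contra: "\<not> (\<exists>y\<in>c00 K. supp y \<subseteq> cone s \<inter> {v. N < last v} \<and>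
        T_norm k d \<theta> (restr (cones F) (\<Psi> y)) < \<epsilon> * T_norm K d \<theta> y)"
  have below: "\<epsilon> * T_norm K d \<theta> y \<le> T_norm k d \<theta> (restr (cones F) (\<Psi> y))"
    if "y \<in> c00 K" "supp y \<subseteq> cone s \<inter> {v. N < last v}" for y
    using contra that by force
  define q where "q = Suc (card F)"
  have q: "0 < q" by (simp add: q_def)
  obtain r where r: "C * (real d / (1 - \<theta>)) / (\<epsilon> / (2 * q)) < (\<theta> * real d) ^ r"
    using real_arch_pow[OF growth] by blast
  \<comment> \<open>Enough vectors for the pigeonhole principle to assign \<open>d ^ r\<close> of
    them to one node of \<open>F\<close>.\<close>
  define n where "n = q * d ^ r"
  \<comment> \<open>Chosen so that \<open>n + 1\<close> errors of size \<open>\<delta>\<close> use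
    up half of the share \<open>\<epsilon> / q\<close>.\<close>
  define \<delta> where "\<delta> = \<epsilon> / (2 * q) / Suc n"
  have \<delta>: "0 < \<delta>" using \<epsilon> q by (simp add: \<delta>_def)
  obtain i0 where i0: "\<And>e. e \<in> set s \<Longrightarrow> e \<le> i0"
    using finite_nat_set_iff_bounded_le[of "set s"] by auto
  \<comment> \<open>Supports beyond \<open>N'\<close> lie above the levels \<open>i0 + j\<close> of
    all children used, as \<open>T_norm_sum_cones\<close> demands.\<close>
  define N' where "N' = max N (i0 + n)"
  have "finite (insert (gap k d) (\<Union>t\<in>F. set t))" using F(1) by simp
  then obtain m0 where m0: "gap k d \<le> m0" "\<And>t e. t \<in> F \<Longrightarrow> e \<in> set t \<Longrightarrow> e \<le> m0"
    unfolding finite_nat_set_iff_bounded_le by auto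
  define ext where "ext m = (\<lambda>(t, b). t @ [b]) ` (F \<times> {..m}) \<inter> ndseq_le k" for m
  have ext: "finite (ext m)" "ext m \<subseteq> {t \<in> ndseq_le k. length t + l = k}" for m
    using F by (auto simp: ext_def)
  \<comment> \<open>One stage of the choice: \<open>y\<close> is normalized and lives above child
    \<open>i0 + j\<close>, its image is small on the children of \<open>F\<close> up to level
    \<open>m\<close>, and the image ends by level \<open>lv\<close>.\<close>
  define P where "P j = (\<lambda>(y, m, lv). y \<in> c00 K \<and> supp y \<subseteq> cone (s @ [i0 + j]) \<inter> {v. N' < last v} \<and>
      T_norm K d \<theta> y = 1 \<and> T_norm k d \<theta> (restr (cones (ext m)) (\<Psi> y)) < \<delta> \<and> m < lv \<and>
      (\<forall>v\<in>supp (\<Psi> y). last v \<le> lv) \<and> m0 \<le> m)" for j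
  have ex: "\<exists>y lv. P j (y, m, lv)" if m: "m0 \<le> m" for j m
  proof -
    have "s @ [i0 + j] \<in> ndseq_le K" "length (s @ [i0 + j]) + l < K"
      using s i0 by (auto simp: ndseq_le_def sorted_append intro: trans_le_add1)
    then obtain y where y: "y \<in> c00 K" "supp y \<subseteq> cone (s @ [i0 + j]) \<inter> {v. N' < last v}"
        "T_norm k d \<theta> (restr (cones (ext m)) (\<Psi> y)) < \<delta> * T_norm K d \<theta> y"
      using esc ext[of m] \<delta> unfolding escapes_def by blast
    let ?c = "T_norm K d \<theta> y" and ?y = "\<lambda>v. inverse (T_norm K d \<theta> y) * y v"
    have "0 < \<delta> * ?c"
      using y(3) T_norm_nonneg[OF d \<theta> k c00_restr[OF \<Psi>_in[OF y(1)]], of "cones (ext m)"] by linarith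
    then have c: "0 < ?c" using \<delta> by (simp add: zero_less_mult_iff)
    have y': "?y \<in> c00 K" by (rule c00_scale[OF y(1)])
    have "finite (insert (Suc m) (last ` supp (\<Psi> ?y)))"
      using \<Psi>_in[OF y'] by (simp add: c00_iff)
    then obtain lv where lv: "Suc m \<le> lv" "\<And>v. v \<in> supp (\<Psi> ?y) \<Longrightarrow> last v \<le> lv"
      unfolding finite_nat_set_iff_bounded_le by auto
    have "T_norm K d \<theta> ?y = 1"
      using T_norm_scale[OF d \<theta> K y(1)] c by simp
    moreover have eq: "T_norm k d \<theta> (restr (cones (ext m)) (\<Psi> ?y)) =
        inverse ?c * T_norm k d \<theta> (restr (cones (ext m)) (\<Psi> y))"
      using T_norm_scale[OF d \<theta> k c00_restr[OF \<Psi>_in[OF y(1)]]] c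
      by (simp add: \<Psi>_scale[OF y(1)] restr_scale)
    have "T_norm k d \<theta> (restr (cones (ext m)) (\<Psi> ?y)) < \<delta>"
      unfolding eq using y(3) c by (simp add: field_simps)
    moreover have "supp ?y \<subseteq> supp y" by (auto simp: supp_def)
    ultimately have "P j (?y, m, lv)"
      using y y' lv m by (auto simp: P_def)
    then show ?thesis by blast
  qed
  obtain f where f: "\<And>j. P j (f j)" "\<And>j. snd (snd (f j)) + gap k d \<le> fst (snd (f (Suc j)))"
  proof -
    have "\<exists>f. \<forall>j. P j (f j) \<and> snd (snd (f j)) + gap k d \<le> fst (snd (f (Suc j)))"
    proof (rule dependent_nat_choice)
      show "\<exists>x. P 0 x" using ex[of m0 0] by blast
      fix x j assume "P j x"
      then have "m0 \<le> snd (snd x) + gap k d" by (auto simp: P_def)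
      then show "\<exists>y. P (Suc j) y \<and> snd (snd x) + gap k d \<le> fst (snd y)"
        using ex[of "snd (snd x) + gap k d" "Suc j"] by fastforce
    qed
    then show ?thesis using that by blast
  qed
  define y m lv where "y j = fst (f j)" and "m j = fst (snd (f j))" and "lv j = snd (snd (f j))" for j
  have y: "y j \<in> c00 K" "supp (y j) \<subseteq> cone (s @ [i0 + j])" "\<And>v. v \<in> supp (y j) \<Longrightarrow> N' < last v"
      "T_norm K d \<theta> (y j) = 1" and small: "T_norm k d \<theta> (restr (cones (ext (m j))) (\<Psi> (y j))) < \<delta>"
    and ml: "m j < lv j" and lev: "\<And>v. v \<in> supp (\<Psi> (y j)) \<Longrightarrow> last v \<le> lv j" and m: "m0 \<le> m j" for j
    using f(1)[of j] by (auto simp: P_def y_def m_def lv_def split: prod.splits)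
  have step: "lv j + gap k d \<le> m (Suc j)" for j
    using f(2) by (simp add: m_def lv_def)
  have lm: "lv i + gap k d \<le> m j" if "i < j" for i j
    using that
  proof (induction j)
    case (Suc j)
    then show ?case using step[of j] ml[of j] by (cases "i = j") auto
  qed simp
  note \<Psi>y = \<Psi>_in[OF y(1)]
  have "\<exists>t\<in>F. \<epsilon> / q \<le> T_norm k d \<theta> (restr (cone t) (\<Psi> (y j)))" for j
  proof (rule ccontr)
    assume no: "\<not> ?thesis"
    have "cone (s @ [i0 + j]) \<subseteq> cone s" by (auto simp: cone_def prefix_def)
    then have "supp (y j) \<subseteq> cone s \<inter> {v. N < last v}"
      using y(2)[of j] y(3)[of _ j] by (fastforce simp: N'_def)
    then have "\<epsilon> \<le> T_norm k d \<theta> (restr (cones F) (\<Psi> (y j)))"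
      using below[OF y(1)[of j]] y(4)[of j] by simp
    also have "\<dots> \<le> (\<Sum>t\<in>F. T_norm k d \<theta> (restr (cone t) (\<Psi> (y j))))"
      unfolding cones_def by (rule T_norm_restr_UN[OF k \<Psi>y F(1)])
    also have "\<dots> \<le> real (card F) * (\<epsilon> / q)"
      using no by (intro sum_bounded_above) force
    also have "\<dots> < \<epsilon>" using \<epsilon> by (simp add: q_def field_simps)
    finally show False by simp
  qed
  then obtain tt where tt: "\<And>j. tt j \<in> F" "\<And>j. \<epsilon> / q \<le> T_norm k d \<theta> (restr (cone (tt j)) (\<Psi> (y j)))"
    by metis
  obtain t where t: "t \<in> F" "card {..<n} \<le> card (tt -` {t} \<inter> {..<n}) * card F"
    using pigeonhole_card[of tt "{..<n}" F] tt(1) F(1) by auto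
  define G where "G = tt -` {t} \<inter> {..<n}"
  have G: "finite G" "G \<subseteq> {..<n}" by (auto simp: G_def)
  have card_G: "d ^ r \<le> card G"
  proof (rule ccontr)
    assume "\<not> d ^ r \<le> card G"
    then have "card G * card F \<le> d ^ r * card F" by (intro mult_le_mono1) simp
    also have "\<dots> < n" using d by (simp add: n_def q_def)
    finally show False using t(2) by (simp add: G_def)
  qed
  obtain h where h: "bij_betw h {..<card G} G" "strict_mono_on {..<card G} h"
    using ex_bij_betw_strict_mono_card[OF G(1)] by blast
  have hG: "h j \<in> G" if "j < d ^ r" for j
    using bij_betwE[OF h(1)] that card_G by auto
  have tk: "t \<in> ndseq_le k" "length t + Suc l = k" using t(1) F(2) by auto
  define x where "x = \<Psi> (\<lambda>v. \<Sum>j\<in>G. y j v)"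
  have sum_in: "(\<lambda>v. \<Sum>j\<in>G. y j v) \<in> c00 K" using y(1) by (intro c00_sum)
  have x: "x \<in> c00 k" unfolding x_def by (rule \<Psi>_in[OF sum_in])
  have large: "\<epsilon> / (2 * q) \<le> T_norm k d \<theta> (restr (band k t (m i) (lv i)) x)" if i: "i \<in> G" for i
  proof -
    let ?B = "band k t (m i) (lv i)"
    let ?rest = "\<lambda>v. \<Sum>j\<in>G - {i}. restr ?B (\<Psi> (y j)) v"
    \<comment> \<open>Earlier images end before the band begins. Later ones are small on it, because
      the children it uses have already been put into \<open>ext (m j)\<close>.\<close>
    have other: "T_norm k d \<theta> (restr ?B (\<Psi> (y j))) \<le> \<delta>" if "j \<noteq> i" for j
    proof (cases "j < i")
      case True
      have "v \<notin> supp (\<Psi> (y j))" if "v \<in> ?B" for v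
      proof -
        have "v ! length t \<in> set v" using that tk(2) by (auto simp: band_def ndseq_def)
        then have "m i < last v"
          using that sorted_le_last[of v "v ! length t"] by (auto simp: band_def ndseq_def)
        then show ?thesis using lev[of v j] lm[OF True] by auto
      qed
      then have "restr ?B (\<Psi> (y j)) = (\<lambda>v. 0)" by (auto simp: restr_def supp_def)
      then show ?thesis using \<delta> by (simp add: T_norm_zero[OF d \<theta> k])
    next
      case False
      then have ij: "i < j" using that by simp
      have "?B \<subseteq> cones (ext (m j))"
      proof
        fix v assume v: "v \<in> ?B"
        then have len: "length t < length v" using tk(2) by (auto simp: band_def ndseq_def)
        have "v ! length t \<le> last v"
          using v len by (intro sorted_le_last) (auto simp: band_def ndseq_def)
        then have "v ! length t \<le> m j" using v lm[OF ij] by (auto simp: band_def)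
        moreover have take: "take (Suc (length t)) v = t @ [v ! length t]"
          using v len by (auto simp: band_def prefix_def take_Suc_conv_app_nth)
        moreover have "take (Suc (length t)) v \<in> ndseq_le k"
          using v ndseq_subset by (intro ndseq_le_take) (auto simp: band_def)
        ultimately have "t @ [v ! length t] \<in> ext (m j)" using t(1) by (auto simp: ext_def)
        moreover have "v \<in> cone (t @ [v ! length t])"
          using take take_is_prefix[of "Suc (length t)" v] by (simp add: cone_def)
        ultimately show "v \<in> cones (ext (m j))" by (auto simp: cones_def)
      qed
      then show ?thesis
        using T_norm_restr_mono[OF d \<theta> k \<Psi>y[of j], of ?B "cones (ext (m j))"] small[of j] by fastforce
    qed
    \<comment> \<open>A leaf above \<open>t\<close> either continues beyond level
      \<open>m i\<close>, which puts it into the band, or passes through a child in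
      \<open>ext (m i)\<close>, where the image is small.\<close>
    have "cone t \<inter> supp (\<Psi> (y i)) \<subseteq> ?B \<union> cones (ext (m i))"
    proof
      fix v assume v: "v \<in> cone t \<inter> supp (\<Psi> (y i))"
      then have vk: "v \<in> ndseq k" using \<Psi>y[of i] by (auto simp: c00_iff)
      have take: "take (Suc (length t)) v = t @ [v ! length t]"
        using v vk tk(2) by (auto simp: cone_def prefix_def ndseq_def take_Suc_conv_app_nth)
      have "take (Suc (length t)) v \<in> ndseq_le k"
        using vk ndseq_subset by (intro ndseq_le_take) auto
      then have "t @ [v ! length t] \<in> ext (m i)" if "v ! length t \<le> m i"
        using t(1) that by (auto simp: ext_def take)
      moreover have "v \<in> cone (t @ [v ! length t])"
        using take take_is_prefix[of "Suc (length t)" v] by (simp add: cone_def)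
      ultimately have "v \<in> cones (ext (m i))" if "v ! length t \<le> m i"
        using that by (auto simp: cones_def)
      then show "v \<in> ?B \<union> cones (ext (m i))"
        using v vk lev[of v i] by (cases "v ! length t \<le> m i") (auto simp: band_def cone_def)
    qed
    then have "T_norm k d \<theta> (restr (cone t) (\<Psi> (y i))) \<le>
        T_norm k d \<theta> (restr (?B \<union> cones (ext (m i))) (\<Psi> (y i)))"
      by (rule T_norm_restr_mono[OF d \<theta> k \<Psi>y])
    also have "\<dots> \<le> T_norm k d \<theta> (restr ?B (\<Psi> (y i))) + T_norm k d \<theta> (restr (cones (ext (m i))) (\<Psi> (y i)))"
      by (rule T_norm_restr_Un[OF k \<Psi>y])
    finally have 1: "\<epsilon> / q \<le> T_norm k d \<theta> (restr ?B (\<Psi> (y i))) + \<delta>"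
      using tt(2)[of i] i small[of i] by (simp add: G_def)
    have rest: "?rest \<in> c00 k" by (intro c00_sum c00_restr \<Psi>y)
    have "restr ?B x = (\<lambda>v. restr ?B (\<Psi> (y i)) v + ?rest v)"
      unfolding x_def Psi_sum[OF G(1) y(1)] restr_sum using sum.remove[OF G(1) i] by fastforce
    then have 2: "T_norm k d \<theta> (restr ?B (\<Psi> (y i))) \<le> T_norm k d \<theta> (restr ?B x) + T_norm k d \<theta> ?rest"
      using T_norm_add_lower[OF k c00_restr[OF \<Psi>y[of i]] rest, of ?B] by simp
    have "T_norm k d \<theta> ?rest \<le> (\<Sum>j\<in>G - {i}. T_norm k d \<theta> (restr ?B (\<Psi> (y j))))"
      by (intro T_norm_sum_le[OF d \<theta> k] c00_restr \<Psi>y)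
    also have "\<dots> \<le> real (card (G - {i})) * \<delta>"
      using other by (intro sum_bounded_above) auto
    also have "\<dots> \<le> real n * \<delta>"
    proof -
      have "card (G - {i}) \<le> n" using card_mono[of "{..<n}" "G - {i}"] G by auto
      then show ?thesis using \<delta> by simp
    qed
    finally have 3: "T_norm k d \<theta> ?rest \<le> real n * \<delta>" .
    have "real n * \<delta> + \<delta> = \<epsilon> / (2 * q)"
    proof -
      have "real n * \<delta> + \<delta> = real (Suc n) * \<delta>" by (simp add: algebra_simps)
      then show ?thesis by (simp add: \<delta>_def del: of_nat_Suc)
    qed
    moreover have "\<epsilon> / q = \<epsilon> / (2 * q) + \<epsilon> / (2 * q)" by simp
    ultimately show ?thesis using 1 2 3 by linarith
  qed
  have "(\<theta> * real d) ^ r * (\<epsilon> / (2 * q)) \<le> T_norm k d \<theta> x"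
  proof (rule T_norm_bands[OF d \<theta> tk(1) _ x, where m = "m \<circ> h" and l = "lv \<circ> h"])
    show "length t < k" using tk(2) by simp
    show "0 \<le> \<epsilon> / (2 * q)" using \<epsilon> by simp
    show "(lv \<circ> h) j + gap k d \<le> (m \<circ> h) (Suc j)" if "Suc j < d ^ r" for j
      using lm[OF strict_mono_onD[OF h(2), of j "Suc j"]] that card_G by simp
    show "\<epsilon> / (2 * q) \<le> T_norm k d \<theta> (restr (band k t ((m \<circ> h) j) ((lv \<circ> h) j)) x)" if "j < d ^ r" for j
      using large[OF hG[OF that]] by simp
    show "gap k d \<le> (m \<circ> h) 0" "\<And>e. e \<in> set t \<Longrightarrow> e \<le> (m \<circ> h) 0"
      using m[of "h 0"] m0 t(1) by (auto intro: order_trans)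
  qed (simp add: ml)
  also have "\<dots> \<le> C * T_norm K d \<theta> (\<lambda>v. \<Sum>j\<in>G. y j v)"
    unfolding x_def by (rule \<Psi>_bound[OF sum_in])
  also have "\<dots> \<le> C * (real d / (1 - \<theta>))"
  proof (rule mult_left_mono[OF _ C], rule T_norm_sum_cones[OF d \<theta> K y(1), where ix = "\<lambda>j. i0 + j" and n = "Suc N'"])
    show "i0 + j < Suc N'" if "j \<in> G" for j
      using that G(2) by (auto simp: N'_def)
    show "Suc N' \<le> last v" if "v \<in> supp (y j)" for j v
      using y(3)[OF that] by simp
  qed (use y G in \<open>auto simp: inj_on_def\<close>)
  finally have "(\<theta> * real d) ^ r * (\<epsilon> / (2 * q)) \<le> C * (real d / (1 - \<theta>))" .
  moreover have "0 < \<epsilon> / (2 * q)" using \<epsilon> q by simp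
  ultimately show False
    using r by (simp only: pos_divide_less_eq)
qed

lemma not_bounded_below:
  assumes growth: "1 < \<theta> * real d" and kK: "k < K" and c: "0 < c"
  shows "\<exists>x\<in>c00 K. T_norm k d \<theta> (\<Psi> x) < c * T_norm K d \<theta> x"
proof -
  have "escapes l" if "l \<le> k" for l
    using that by (induction l) (simp_all add: escapes_0 escapes_Suc growth)
  then have "escapes k" by simp
  moreover have "[] \<in> ndseq_le K" "{[]} \<subseteq> {t \<in> ndseq_le k. length t + k = k}"
    by (auto simp: ndseq_le_def)
  ultimately obtain y where "y \<in> c00 K"
      "T_norm k d \<theta> (restr (cones {[]}) (\<Psi> y)) < c * T_norm K d \<theta> y"
    unfolding escapes_def using kK c
    by (metis (no_types, lifting) add_0 finite.emptyI finite.insertI list.size(3))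
  moreover have "restr (cones {[]}) x = x" for x
    by (auto simp: restr_def cones_def cone_def)
  ultimately show ?thesis by auto
qed

end
end

section \<open>Completions and their isomorphisms\<close>

text \<open>The axioms of a seminorm; vectors at distance 0 become equal in the completion.\<close>

locale norm_on =
  fixes V :: "('i \<Rightarrow> real) set" and p :: "('i \<Rightarrow> real) \<Rightarrow> real"
  assumes zero_in: "(\<lambda>v. 0) \<in> V"
    and add_in: "x \<in> V \<Longrightarrow> y \<in> V \<Longrightarrow> (\<lambda>v. x v + y v) \<in> V"
    and scale_in: "x \<in> V \<Longrightarrow> (\<lambda>v. c * x v) \<in> V"
    and p_triangle: "x \<in> V \<Longrightarrow> y \<in> V \<Longrightarrow> p (\<lambda>v. x v + y v) \<le> p x + p y"
    and p_scale: "x \<in> V \<Longrightarrow> p (\<lambda>v. c * x v) = \<bar>c\<bar> * p x"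
    and p_nonneg: "x \<in> V \<Longrightarrow> 0 \<le> p x"
begin

abbreviation "S \<equiv> cauchy_seqs V p"
abbreviation "R \<equiv> null_rel V p"
abbreviation "E \<equiv> completion V p"

definition cls :: "(nat \<Rightarrow> 'i \<Rightarrow> real) \<Rightarrow> (nat \<Rightarrow> 'i \<Rightarrow> real) set" where
  "cls s = R `` {s}"

definition dis :: "(nat \<Rightarrow> 'i \<Rightarrow> real) set \<Rightarrow> (nat \<Rightarrow> 'i \<Rightarrow> real) set \<Rightarrow> real" where
  "dis A B = nrm E (add E A (scale E (-1) B))"

definition emb :: "('i \<Rightarrow> real) \<Rightarrow> (nat \<Rightarrow> 'i \<Rightarrow> real) set" where
  "emb x = cls (\<lambda>n. x)"

lemma diff_in: "x \<in> V \<Longrightarrow> y \<in> V \<Longrightarrow> (\<lambda>v. x v - y v) \<in> V"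
  using add_in[of x "\<lambda>v. -1 * y v"] scale_in[of y "-1"] by simp

lemma p_zero: "p (\<lambda>v. 0) = 0"
  using p_scale[OF zero_in, of 0] by simp

lemma p_minus: "x \<in> V \<Longrightarrow> y \<in> V \<Longrightarrow> p (\<lambda>v. x v - y v) = p (\<lambda>v. y v - x v)"
  using p_scale[OF diff_in, of x y "-1"] by simp

lemma p_diff_triangle:
  "x \<in> V \<Longrightarrow> y \<in> V \<Longrightarrow> z \<in> V \<Longrightarrow> p (\<lambda>v. x v - z v) \<le> p (\<lambda>v. x v - y v) + p (\<lambda>v. y v - z v)"
  using p_triangle[OF diff_in diff_in, of x y y z] by simp

lemma p_le_diff: "x \<in> V \<Longrightarrow> y \<in> V \<Longrightarrow> p x \<le> p (\<lambda>v. x v - y v) + p y"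
  using p_triangle[OF diff_in, of x y y] by simp

lemma abs_p_diff: "x \<in> V \<Longrightarrow> y \<in> V \<Longrightarrow> \<bar>p x - p y\<bar> \<le> p (\<lambda>v. x v - y v)"
  using p_le_diff[of x y] p_le_diff[of y x] p_minus[of x y] by simp

section \<open>Cauchy sequences and the limits of their norms\<close>

lemma S_in: "s \<in> S \<Longrightarrow> s n \<in> V"
  by (auto simp: cauchy_seqs_def)

lemma S_cauchy: "s \<in> S \<Longrightarrow> 0 < e \<Longrightarrow> \<exists>N. \<forall>m\<ge>N. \<forall>n\<ge>N. p (\<lambda>v. s m v - s n v) < e"
  by (auto simp: cauchy_seqs_def)

lemma S_I:
  "(\<And>n. s n \<in> V) \<Longrightarrow> (\<And>e. 0 < e \<Longrightarrow> \<exists>N. \<forall>m\<ge>N. \<forall>n\<ge>N. p (\<lambda>v. s m v - s n v) < e) \<Longrightarrow> s \<in> S"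
  by (auto simp: cauchy_seqs_def)

lemma S_const: "x \<in> V \<Longrightarrow> (\<lambda>n. x) \<in> S"
  by (rule S_I) (auto simp: p_zero)

lemma S_add:
  assumes s: "s \<in> S" and t: "t \<in> S"
  shows "(\<lambda>n v. s n v + t n v) \<in> S"
proof (rule S_I)
  show "(\<lambda>v. s n v + t n v) \<in> V" for n using S_in s t add_in by blast
  fix e :: real assume e: "0 < e"
  obtain M where M: "\<And>m n. M \<le> m \<Longrightarrow> M \<le> n \<Longrightarrow> p (\<lambda>v. s m v - s n v) < e / 2"
    using S_cauchy[OF s, of "e / 2"] e by auto
  obtain N where N: "\<And>m n. N \<le> m \<Longrightarrow> N \<le> n \<Longrightarrow> p (\<lambda>v. t m v - t n v) < e / 2"
    using S_cauchy[OF t, of "e / 2"] e by auto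
  have "p (\<lambda>v. s m v + t m v - (s n v + t n v)) < e" if "max M N \<le> m" "max M N \<le> n" for m n
    using p_triangle[OF diff_in[OF S_in[OF s, of m] S_in[OF s, of n]] diff_in[OF S_in[OF t, of m] S_in[OF t, of n]]]
      M[of m n] N[of m n] that by (simp add: algebra_simps)
  then show "\<exists>N. \<forall>m\<ge>N. \<forall>n\<ge>N. p (\<lambda>v. s m v + t m v - (s n v + t n v)) < e"
    by blast
qed

lemma S_scale:
  assumes s: "s \<in> S"
  shows "(\<lambda>n v. c * s n v) \<in> S"
proof (rule S_I)
  show "(\<lambda>v. c * s n v) \<in> V" for n using S_in s scale_in by blast
  fix e :: real assume e: "0 < e"
  obtain M where M: "\<And>m n. M \<le> m \<Longrightarrow> M \<le> n \<Longrightarrow> p (\<lambda>v. s m v - s n v) < e / (\<bar>c\<bar> + 1)"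
    using S_cauchy[OF s, of "e / (\<bar>c\<bar> + 1)"] e by auto
  have "p (\<lambda>v. c * s m v - c * s n v) < e" if "M \<le> m" "M \<le> n" for m n
  proof -
    have "p (\<lambda>v. c * s m v - c * s n v) = \<bar>c\<bar> * p (\<lambda>v. s m v - s n v)"
      using p_scale[OF diff_in[OF S_in[OF s] S_in[OF s]], of c m n] by (simp add: algebra_simps)
    also have "\<dots> \<le> (\<bar>c\<bar> + 1) * p (\<lambda>v. s m v - s n v)"
      using p_nonneg[OF diff_in[OF S_in[OF s] S_in[OF s]], of m n] by (simp add: algebra_simps)
    also have "\<dots> < e" using M[OF that] by (simp add: field_simps)
    finally show ?thesis .
  qed
  then show "\<exists>N. \<forall>m\<ge>N. \<forall>n\<ge>N. p (\<lambda>v. c * s m v - c * s n v) < e" by blast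
qed

lemma S_diff: "s \<in> S \<Longrightarrow> t \<in> S \<Longrightarrow> (\<lambda>n v. s n v - t n v) \<in> S"
  using S_add[of s "\<lambda>n v. -1 * t n v"] S_scale[of t "-1"] by simp

text \<open>The norm of the completion on representatives; \<open>sn_lim\<close> shows that the
  limit exists on \<open>S\<close>.\<close>

definition sn :: "(nat \<Rightarrow> 'i \<Rightarrow> real) \<Rightarrow> real" where
  "sn s = lim (\<lambda>n. p (s n))"

lemma sn_lim:
  assumes s: "s \<in> S"
  shows "(\<lambda>n. p (s n)) \<longlonglongrightarrow> sn s"
proof -
  have "Cauchy (\<lambda>n. p (s n))"
  proof (rule CauchyI)
    fix e :: real assume "0 < e"
    then obtain M where M: "\<forall>m\<ge>M. \<forall>n\<ge>M. p (\<lambda>v. s m v - s n v) < e"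
      using S_cauchy[OF s] by blast
    have "norm (p (s m) - p (s n)) < e" if "M \<le> m" "M \<le> n" for m n
      using abs_p_diff[OF S_in[OF s, of m] S_in[OF s, of n]] M that by fastforce
    then show "\<exists>M. \<forall>m\<ge>M. \<forall>n\<ge>M. norm (p (s m) - p (s n)) < e" by blast
  qed
  then show ?thesis
    unfolding sn_def using Cauchy_convergent_iff convergent_LIMSEQ_iff by blast
qed

lemma sn_eqI: "s \<in> S \<Longrightarrow> (\<lambda>n. p (s n)) \<longlonglongrightarrow> r \<Longrightarrow> sn s = r"
  using sn_lim LIMSEQ_unique by blast

lemma sn_mono:
  "s \<in> S \<Longrightarrow> t \<in> S \<Longrightarrow> u \<in> S \<Longrightarrow> (\<And>n. p (s n) \<le> p (t n) + p (u n)) \<Longrightarrow> sn s \<le> sn t + sn u"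
  by (rule LIMSEQ_le[OF sn_lim tendsto_add[OF sn_lim sn_lim]]) auto

lemma sn_nonneg: "s \<in> S \<Longrightarrow> 0 \<le> sn s"
  by (rule LIMSEQ_le_const[OF sn_lim]) (auto intro: p_nonneg S_in)

lemma sn_scale: "s \<in> S \<Longrightarrow> sn (\<lambda>n v. c * s n v) = \<bar>c\<bar> * sn s"
  by (rule sn_eqI[OF S_scale]) (auto simp: p_scale S_in intro: tendsto_mult sn_lim)

lemma sn_const: "x \<in> V \<Longrightarrow> sn (\<lambda>n. x) = p x"
  by (rule sn_eqI[OF S_const]) auto

lemma sn_add: "s \<in> S \<Longrightarrow> t \<in> S \<Longrightarrow> sn (\<lambda>n v. s n v + t n v) \<le> sn s + sn t"
  by (rule sn_mono[OF S_add]) (auto intro: p_triangle S_in)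

lemma sn_minus: "s \<in> S \<Longrightarrow> t \<in> S \<Longrightarrow> sn (\<lambda>n v. s n v - t n v) = sn (\<lambda>n v. t n v - s n v)"
  using sn_scale[OF S_diff, of s t "-1"] by simp

lemma R_iff: "(s, t) \<in> R \<longleftrightarrow> s \<in> S \<and> t \<in> S \<and> sn (\<lambda>n v. s n v - t n v) = 0"
  using sn_lim[OF S_diff] sn_eqI[OF S_diff] by (force simp: null_rel_def)

lemma equiv_R: "equiv S R"
proof (rule equivI)
  show "R \<subseteq> S \<times> S" by (auto simp: null_rel_def)
  show "refl_on S R" by (auto simp: refl_on_def R_iff sn_const[OF zero_in, unfolded p_zero])
  show "sym R"
  proof (rule symI)
    fix s t assume "(s, t) \<in> R"
    then show "(t, s) \<in> R" using sn_minus[of t s] by (simp add: R_iff)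
  qed
  show "trans R"
  proof (rule transI)
    fix s t u assume st: "(s, t) \<in> R" "(t, u) \<in> R"
    then have in_S: "s \<in> S" "t \<in> S" "u \<in> S" by (auto simp: R_iff)
    have "sn (\<lambda>n v. s n v - u n v) \<le> sn (\<lambda>n v. s n v - t n v) + sn (\<lambda>n v. t n v - u n v)"
      using in_S by (intro sn_mono S_diff p_diff_triangle S_in)
    then show "(s, u) \<in> R"
      using st in_S sn_nonneg[OF S_diff, of s u] by (auto simp: R_iff)
  qed
qed

section \<open>The operations of the completion on representatives\<close>

lemma car_E: "car E = cls ` S"
  by (auto simp: completion_def quotient_def cls_def)

lemma carE:
  assumes "A \<in> car E"
  obtains s where "s \<in> S" "A = cls s"
  using assms by (auto simp: car_E)

lemma carE2:
  assumes "A \<in> car E" "B \<in> car E"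
  obtains s t where "s \<in> S" "A = cls s" "t \<in> S" "B = cls t"
  using assms unfolding car_E by blast

lemma cls_in: "s \<in> S \<Longrightarrow> cls s \<in> car E"
  by (auto simp: car_E)

lemma cls_eq_iff: "s \<in> S \<Longrightarrow> t \<in> S \<Longrightarrow> cls s = cls t \<longleftrightarrow> sn (\<lambda>n v. s n v - t n v) = 0"
  unfolding cls_def using eq_equiv_class_iff[OF equiv_R] by (auto simp: R_iff)

lemma cls_eqI: "(s, t) \<in> R \<Longrightarrow> cls s = cls t"
  unfolding cls_def by (rule equiv_class_eq[OF equiv_R])

lemma add_cls:
  assumes "s \<in> S" "t \<in> S"
  shows "add E (cls s) (cls t) = cls (\<lambda>n v. s n v + t n v)"
proof -
  have "(\<lambda>s t. R `` {\<lambda>n v. s n v + t n v}) respects2 R"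
  proof (rule congruent2I')
    fix s s' t t' assume st: "(s, s') \<in> R" "(t, t') \<in> R"
    then have in_S: "s \<in> S" "t \<in> S" "s' \<in> S" "t' \<in> S" by (auto simp: R_iff)
    have "sn (\<lambda>n v. s n v + t n v - (s' n v + t' n v)) = sn (\<lambda>n v. (s n v - s' n v) + (t n v - t' n v))"
      by (simp add: algebra_simps)
    also have "\<dots> \<le> sn (\<lambda>n v. s n v - s' n v) + sn (\<lambda>n v. t n v - t' n v)"
      using in_S by (intro sn_add S_diff)
    finally have "sn (\<lambda>n v. s n v + t n v - (s' n v + t' n v)) = 0"
      using st sn_nonneg[OF S_diff[OF S_add S_add], of s t s' t'] in_S by (simp add: R_iff)
    then have "(\<lambda>n v. s n v + t n v, \<lambda>n v. s' n v + t' n v) \<in> R"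
      using in_S by (simp add: R_iff S_add)
    then show "R `` {\<lambda>n v. s n v + t n v} = R `` {\<lambda>n v. s' n v + t' n v}"
      using cls_eqI by (simp add: cls_def)
  qed
  then show ?thesis
    using UN_equiv_class2[OF equiv_R equiv_R] assms by (simp add: completion_def cls_def)
qed

lemma scale_cls:
  assumes "s \<in> S"
  shows "scale E c (cls s) = cls (\<lambda>n v. c * s n v)"
proof -
  have "(\<lambda>s. R `` {\<lambda>n v. c * s n v}) respects R"
  proof (rule congruentI)
    fix s s' assume st: "(s, s') \<in> R"
    then have in_S: "s \<in> S" "s' \<in> S" by (auto simp: R_iff)
    have "sn (\<lambda>n v. c * s n v - c * s' n v) = 0"
      using sn_scale[OF S_diff[OF in_S], of c] st by (simp add: R_iff right_diff_distrib)
    then have "(\<lambda>n v. c * s n v, \<lambda>n v. c * s' n v) \<in> R"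
      using in_S by (simp add: R_iff S_scale)
    then show "R `` {\<lambda>n v. c * s n v} = R `` {\<lambda>n v. c * s' n v}"
      using cls_eqI by (simp add: cls_def)
  qed
  then show ?thesis
    using UN_equiv_class[OF equiv_R] assms by (simp add: completion_def cls_def)
qed

text \<open>Equivalent sequences have the same limit norm by the triangle inequality, so the value
  described by \<open>THE\<close> is unique.\<close>

lemma nrm_cls:
  assumes s: "s \<in> S"
  shows "nrm E (cls s) = sn s"
proof -
  have *: "r = sn s" if "t \<in> cls s" "(\<lambda>n. p (t n)) \<longlonglongrightarrow> r" for t r
  proof -
    have st: "(s, t) \<in> R" using that by (simp add: cls_def)
    then have t: "t \<in> S" by (simp add: R_iff)
    have "sn s \<le> sn (\<lambda>n v. s n v - t n v) + sn t"
      by (intro sn_mono s t S_diff p_le_diff S_in)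
    moreover have "sn t \<le> sn (\<lambda>n v. t n v - s n v) + sn s"
      by (intro sn_mono s t S_diff p_le_diff S_in)
    ultimately have "sn t = sn s" using st sn_minus[OF s t] by (simp add: R_iff)
    then show ?thesis using sn_eqI[OF t that(2)] by simp
  qed
  have "s \<in> cls s" using equiv_class_self[OF equiv_R s] by (simp add: cls_def)
  then have "(THE r. \<exists>t\<in>cls s. (\<lambda>n. p (t n)) \<longlonglongrightarrow> r) = sn s"
    using * sn_lim[OF s] by (intro the_equality) blast+
  then show ?thesis by (simp add: completion_def)
qed

lemma add_closed: "A \<in> car E \<Longrightarrow> B \<in> car E \<Longrightarrow> add E A B \<in> car E"
  by (auto simp: car_E add_cls S_add)

lemma scale_closed: "A \<in> car E \<Longrightarrow> scale E c A \<in> car E"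
  by (auto simp: car_E scale_cls S_scale)

lemma nrm_nonneg: "A \<in> car E \<Longrightarrow> 0 \<le> nrm E A"
  by (auto simp: car_E nrm_cls sn_nonneg)

lemma nrm_scale: "A \<in> car E \<Longrightarrow> nrm E (scale E c A) = \<bar>c\<bar> * nrm E A"
  by (auto simp: car_E scale_cls nrm_cls sn_scale S_scale)

lemma dis_cls: "s \<in> S \<Longrightarrow> t \<in> S \<Longrightarrow> dis (cls s) (cls t) = sn (\<lambda>n v. s n v - t n v)"
  unfolding dis_def by (simp only: scale_cls S_scale add_cls S_add nrm_cls) simp

lemma dis_nonneg: "A \<in> car E \<Longrightarrow> B \<in> car E \<Longrightarrow> 0 \<le> dis A B"
  by (erule (1) carE2) (simp add: dis_cls sn_nonneg S_diff)

lemma dis_commute: "A \<in> car E \<Longrightarrow> B \<in> car E \<Longrightarrow> dis A B = dis B A"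
  by (erule (1) carE2) (simp add: dis_cls, rule sn_minus)

lemma dis_eq_0: "A \<in> car E \<Longrightarrow> B \<in> car E \<Longrightarrow> dis A B = 0 \<longleftrightarrow> A = B"
  by (erule (1) carE2) (simp add: dis_cls cls_eq_iff)

lemma dis_triangle:
  assumes "A \<in> car E" "B \<in> car E" "C \<in> car E"
  shows "dis A C \<le> dis A B + dis B C"
proof -
  obtain s t u where "s \<in> S" "A = cls s" "t \<in> S" "B = cls t" "u \<in> S" "C = cls u"
    using assms by (blast elim: carE)
  then show ?thesis
    by (simp add: dis_cls) (intro sn_mono S_diff p_diff_triangle S_in; assumption)
qed

lemma nrm_le_dis:
  assumes "A \<in> car E" "B \<in> car E"
  shows "nrm E A \<le> dis A B + nrm E B"
proof -
  obtain s t where st: "s \<in> S" "A = cls s" "t \<in> S" "B = cls t"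
    using assms by (blast elim: carE)
  then show ?thesis
    using sn_add[OF S_diff[OF st(1,3)] st(3)] by (simp add: dis_cls nrm_cls)
qed

lemma dis_add_le:
  assumes "A \<in> car E" "B \<in> car E" "A' \<in> car E" "B' \<in> car E"
  shows "dis (add E A B) (add E A' B') \<le> dis A A' + dis B B'"
proof -
  obtain s t s' t' where st: "s \<in> S" "A = cls s" "t \<in> S" "B = cls t" "s' \<in> S" "A' = cls s'" "t' \<in> S" "B' = cls t'"
    using assms by (auto elim!: carE)
  then have "dis (add E A B) (add E A' B') = sn (\<lambda>n v. (s n v - s' n v) + (t n v - t' n v))"
    by (simp add: add_cls dis_cls S_add algebra_simps)
  also have "\<dots> \<le> dis A A' + dis B B'"
    using st by (simp add: dis_cls sn_add S_diff)
  finally show ?thesis .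
qed

lemma dis_scale:
  assumes "A \<in> car E" "B \<in> car E"
  shows "dis (scale E c A) (scale E c B) = \<bar>c\<bar> * dis A B"
proof -
  obtain s t where st: "s \<in> S" "A = cls s" "t \<in> S" "B = cls t"
    using assms by (blast elim: carE)
  then show ?thesis
    using sn_scale[OF S_diff[OF st(1,3)], of c] by (simp add: scale_cls dis_cls S_scale right_diff_distrib)
qed

lemma emb_in: "x \<in> V \<Longrightarrow> emb x \<in> car E"
  by (simp add: emb_def cls_in S_const)

lemma nrm_emb: "x \<in> V \<Longrightarrow> nrm E (emb x) = p x"
  by (simp add: emb_def nrm_cls S_const sn_const)

lemma emb_add: "x \<in> V \<Longrightarrow> y \<in> V \<Longrightarrow> emb (\<lambda>v. x v + y v) = add E (emb x) (emb y)"
  by (simp add: emb_def add_cls S_const)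

lemma emb_scale: "x \<in> V \<Longrightarrow> emb (\<lambda>v. c * x v) = scale E c (emb x)"
  by (simp add: emb_def scale_cls S_const)

text \<open>A Cauchy sequence is close to the constant sequence of one of its late terms.\<close>

lemma emb_dense:
  assumes "A \<in> car E" "0 < e"
  shows "\<exists>x\<in>V. dis A (emb x) < e"
proof -
  obtain s where s: "s \<in> S" "A = cls s" using assms by (auto elim!: carE)
  obtain N where N: "\<And>m n. N \<le> m \<Longrightarrow> N \<le> n \<Longrightarrow> p (\<lambda>v. s m v - s n v) < e / 2"
    using S_cauchy[OF s(1), of "e / 2"] assms(2) by auto
  have in_V: "s N \<in> V" using S_in s by blast
  have "sn (\<lambda>n v. s n v - s N v) \<le> e / 2"
    by (rule LIMSEQ_le_const2[OF sn_lim[OF S_diff[OF s(1) S_const[OF in_V]]]])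
      (use N in \<open>auto intro!: exI[of _ N] less_imp_le\<close>)
  then have "dis A (emb (s N)) < e"
    using assms(2) s S_const[OF in_V] by (simp add: emb_def dis_cls)
  then show ?thesis using in_V by blast
qed

lemma Metric_space_E: "Metric_space (car E) (\<lambda>A B. if A \<in> car E \<and> B \<in> car E then dis A B else 0)"
  by unfold_locales (auto simp: dis_nonneg dis_commute dis_eq_0 dis_triangle)

lemma ntop_E: "ntop E = Metric_space.mtopology (car E) (\<lambda>A B. if A \<in> car E \<and> B \<in> car E then dis A B else 0)"
  unfolding ntop_def dis_def by (rule refl)

lemma topspace_E: "topspace (ntop E) = car E"
  unfolding ntop_E by (rule Metric_space.topspace_mtopology[OF Metric_space_E])

end

text \<open>Continuity at 0 bounds \<open>\<Phi>\<close> on a ball of radius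
  \<open>\<delta>\<close>, and homogeneity extends the bound to all vectors.\<close>

lemma continuous_imp_bounded:
  assumes N1: "norm_on V p" and N2: "norm_on W q"
    and cont: "continuous_map (ntop (completion V p)) (ntop (completion W q)) \<Phi>"
    and scale: "\<And>c A. A \<in> car (completion V p) \<Longrightarrow>
      \<Phi> (scale (completion V p) c A) = scale (completion W q) c (\<Phi> A)"
  shows "\<exists>C>0. \<forall>A\<in>car (completion V p). nrm (completion W q) (\<Phi> A) \<le> C * nrm (completion V p) A"
proof -
  interpret A: norm_on V p by (rule N1)
  interpret B: norm_on W q by (rule N2)
  define z where "z = A.emb (\<lambda>v. 0)"
  have z: "z \<in> car A.E" unfolding z_def by (rule A.emb_in[OF A.zero_in])
  have into: "\<Phi> A \<in> car B.E" if "A \<in> car A.E" for A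
    using continuous_map_image_subset_topspace[OF cont] that by (auto simp: A.topspace_E B.topspace_E)
  have dz: "A.dis z A = nrm A.E A" if A: "A \<in> car A.E" for A
  proof -
    obtain s where s: "s \<in> A.S" "A = A.cls s" using A by (rule A.carE)
    have "A.dis A z = nrm A.E A"
      using s A.S_const[OF A.zero_in] by (simp add: z_def A.emb_def A.dis_cls A.nrm_cls)
    then show ?thesis using A.dis_commute[OF A z] by simp
  qed
  have "nrm B.E (\<Phi> z) = 0"
  proof -
    have "A.emb (\<lambda>v. 0 * 0) = scale A.E 0 z"
      unfolding z_def by (rule A.emb_scale[OF A.zero_in])
    then have "z = scale A.E 0 z" by (simp add: z_def)
    then show ?thesis using scale[OF z, of 0] B.nrm_scale[OF into[OF z], of 0] by simp
  qed
  note \<Phi>z = this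
  obtain \<delta> where \<delta>: "0 < \<delta>" "\<And>A. A \<in> car A.E \<Longrightarrow> nrm A.E A < \<delta> \<Longrightarrow> B.dis (\<Phi> z) (\<Phi> A) < 1"
  proof -
    have "\<exists>\<delta>>0. \<forall>A. A \<in> car A.E \<and> (if z \<in> car A.E \<and> A \<in> car A.E then A.dis z A else 0) < \<delta> \<longrightarrow>
        (if \<Phi> z \<in> car B.E \<and> \<Phi> A \<in> car B.E then B.dis (\<Phi> z) (\<Phi> A) else 0) < 1"
      using cont z
      unfolding A.ntop_E B.ntop_E Metric_space.metric_continuous_map[OF A.Metric_space_E B.Metric_space_E]
      by (metis zero_less_one)
    then show ?thesis
      using that z into dz by fastforce
  qed
  have small: "nrm B.E (\<Phi> A) < 1" if "A \<in> car A.E" "nrm A.E A < \<delta>" for A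
    using \<delta>(2)[OF that] B.nrm_le_dis[OF into[OF that(1)] into[OF z]] \<Phi>z
      B.dis_commute[OF into[OF that(1)] into[OF z]] by simp
  have "nrm B.E (\<Phi> A) \<le> 2 / \<delta> * nrm A.E A" if A: "A \<in> car A.E" for A
  proof -
    have scaled: "c * nrm B.E (\<Phi> A) < 1" if "0 < c" "c * nrm A.E A < \<delta>" for c
      using small[OF A.scale_closed[OF A], of c] A.nrm_scale[OF A] scale[OF A] B.nrm_scale[OF into[OF A]] that
      by simp
    show ?thesis
    proof (cases "nrm A.E A = 0")
      case True
      \<comment> \<open>All multiples of \<open>A\<close> lie in the ball, so a positive norm of the
        image could be scaled up to 1.\<close>
      have "\<not> 0 < nrm B.E (\<Phi> A)"
        using scaled[of "1 / nrm B.E (\<Phi> A)"] True \<delta>(1) by auto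
      then show ?thesis using True by simp
    next
      case False
      then have pos: "0 < nrm A.E A" using A.nrm_nonneg[OF A] by simp
      then have "\<delta> / (2 * nrm A.E A) * nrm B.E (\<Phi> A) < 1"
        using \<delta>(1) by (intro scaled) auto
      then show ?thesis using pos \<delta>(1) by (simp add: field_simps)
    qed
  qed
  then show ?thesis using \<delta>(1) by (intro exI[of _ "2 / \<delta>"]) auto
qed

lemma isomorphic_bounds:
  assumes N1: "norm_on V p" and N2: "norm_on W q"
    and iso: "isomorphic (completion V p) (completion W q)"
  obtains \<Phi> C where "0 < C"
    "\<And>A. A \<in> car (completion V p) \<Longrightarrow> \<Phi> A \<in> car (completion W q)"
    "\<And>A B. A \<in> car (completion V p) \<Longrightarrow> B \<in> car (completion V p) \<Longrightarrow>
      \<Phi> (add (completion V p) A B) = add (completion W q) (\<Phi> A) (\<Phi> B)"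
    "\<And>c A. A \<in> car (completion V p) \<Longrightarrow>
      \<Phi> (scale (completion V p) c A) = scale (completion W q) c (\<Phi> A)"
    "\<And>A. A \<in> car (completion V p) \<Longrightarrow> nrm (completion W q) (\<Phi> A) \<le> C * nrm (completion V p) A"
    "\<And>A. A \<in> car (completion V p) \<Longrightarrow> nrm (completion V p) A \<le> C * nrm (completion W q) (\<Phi> A)"
proof -
  interpret A: norm_on V p by (rule N1)
  interpret B: norm_on W q by (rule N2)
  obtain \<Phi> where \<Phi>: "\<forall>A\<in>car A.E. \<forall>B\<in>car A.E. \<Phi> (add A.E A B) = add B.E (\<Phi> A) (\<Phi> B)"
      "\<forall>c. \<forall>A\<in>car A.E. \<Phi> (scale A.E c A) = scale B.E c (\<Phi> A)"
    and hom: "homeomorphic_map (ntop A.E) (ntop B.E) \<Phi>"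
    using iso unfolding isomorphic_def by (elim exE conjE)
  note add = \<Phi>(1)[rule_format] and scale = \<Phi>(2)[rule_format]
  obtain \<Phi>' where maps: "continuous_map (ntop A.E) (ntop B.E) \<Phi>" "continuous_map (ntop B.E) (ntop A.E) \<Phi>'"
      "\<And>A. A \<in> car A.E \<Longrightarrow> \<Phi>' (\<Phi> A) = A" "\<And>A. A \<in> car B.E \<Longrightarrow> \<Phi> (\<Phi>' A) = A"
    using hom by (auto simp: homeomorphic_map_maps homeomorphic_maps_def A.topspace_E B.topspace_E)
  have into: "\<Phi> A \<in> car B.E" if "A \<in> car A.E" for A
    using continuous_map_image_subset_topspace[OF maps(1)] that by (auto simp: A.topspace_E B.topspace_E)
  have into': "\<Phi>' A \<in> car A.E" if "A \<in> car B.E" for A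
    using continuous_map_image_subset_topspace[OF maps(2)] that by (auto simp: A.topspace_E B.topspace_E)
  have scale': "\<Phi>' (scale B.E c A) = scale A.E c (\<Phi>' A)" if "A \<in> car B.E" for c A
    using scale[OF into'[OF that], of c] maps(3)[OF A.scale_closed[OF into'[OF that]]] maps(4)[OF that] by metis
  obtain C1 where C1: "0 < C1" "\<And>A. A \<in> car A.E \<Longrightarrow> nrm B.E (\<Phi> A) \<le> C1 * nrm A.E A"
    using continuous_imp_bounded[OF N1 N2 maps(1) scale] by blast
  obtain C2 where C2: "0 < C2" "\<And>A. A \<in> car B.E \<Longrightarrow> nrm A.E (\<Phi>' A) \<le> C2 * nrm B.E A"
    using continuous_imp_bounded[OF N2 N1 maps(2) scale'] by blast
  show ?thesis
  proof (rule that[of "max C1 C2" \<Phi>])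
    fix A assume A: "A \<in> car A.E"
    have "nrm B.E (\<Phi> A) \<le> C1 * nrm A.E A" by (rule C1(2)[OF A])
    also have "\<dots> \<le> max C1 C2 * nrm A.E A" by (intro mult_right_mono A.nrm_nonneg A) simp
    finally show "nrm B.E (\<Phi> A) \<le> max C1 C2 * nrm A.E A" .
    have "nrm A.E A \<le> C2 * nrm B.E (\<Phi> A)" using C2(2)[OF into[OF A]] maps(3)[OF A] by simp
    also have "\<dots> \<le> max C1 C2 * nrm B.E (\<Phi> A)" by (intro mult_right_mono B.nrm_nonneg into A) simp
    finally show "nrm A.E A \<le> max C1 C2 * nrm B.E (\<Phi> A)" .
  qed (use C1 into add scale in auto)
qed

text \<open>The inverse map inherits linearity. This lets the space of larger depth always be taken
  as the domain.\<close>

lemma isomorphic_sym: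
  assumes N1: "norm_on V p" and N2: "norm_on W q"
    and iso: "isomorphic (completion V p) (completion W q)"
  shows "isomorphic (completion W q) (completion V p)"
proof -
  interpret A: norm_on V p by (rule N1)
  interpret B: norm_on W q by (rule N2)
  obtain \<Phi> where \<Phi>: "\<forall>A\<in>car A.E. \<forall>B\<in>car A.E. \<Phi> (add A.E A B) = add B.E (\<Phi> A) (\<Phi> B)"
      "\<forall>c. \<forall>A\<in>car A.E. \<Phi> (scale A.E c A) = scale B.E c (\<Phi> A)"
    and hom: "homeomorphic_map (ntop A.E) (ntop B.E) \<Phi>"
    using iso unfolding isomorphic_def by (elim exE conjE)
  note add = \<Phi>(1)[rule_format] and scale = \<Phi>(2)[rule_format]
  obtain \<Phi>' where maps: "homeomorphic_maps (ntop A.E) (ntop B.E) \<Phi> \<Phi>'"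
    using hom by (auto simp: homeomorphic_map_maps)
  have inv: "\<And>A. A \<in> car A.E \<Longrightarrow> \<Phi>' (\<Phi> A) = A" "\<And>A. A \<in> car B.E \<Longrightarrow> \<Phi> (\<Phi>' A) = A"
    and cont: "continuous_map (ntop B.E) (ntop A.E) \<Phi>'"
    using maps by (auto simp: homeomorphic_maps_def A.topspace_E B.topspace_E)
  have into': "\<Phi>' A \<in> car A.E" if "A \<in> car B.E" for A
    using continuous_map_image_subset_topspace[OF cont] that by (auto simp: A.topspace_E B.topspace_E)
  have "\<Phi>' (scale B.E c A) = scale A.E c (\<Phi>' A)" if "A \<in> car B.E" for c A
    using scale[OF into'[OF that], of c] inv(1)[OF A.scale_closed[OF into'[OF that]]] inv(2)[OF that] by metis
  moreover have "\<Phi>' (add B.E A B) = add A.E (\<Phi>' A) (\<Phi>' B)" if "A \<in> car B.E" "B \<in> car B.E" for A B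
  proof -
    have "\<Phi>' (add B.E A B) = \<Phi>' (add B.E (\<Phi> (\<Phi>' A)) (\<Phi> (\<Phi>' B)))"
      using inv(2) that by simp
    also have "\<dots> = \<Phi>' (\<Phi> (add A.E (\<Phi>' A) (\<Phi>' B)))"
      using add into' that by simp
    also have "\<dots> = add A.E (\<Phi>' A) (\<Phi>' B)"
      using that by (intro inv(1) A.add_closed into')
    finally show ?thesis .
  qed
  moreover have "homeomorphic_map (ntop B.E) (ntop A.E) \<Phi>'"
    using maps homeomorphic_maps_sym homeomorphic_maps_map by blast
  ultimately show ?thesis
    unfolding isomorphic_def by (intro exI[of _ \<Phi>']) auto
qed

context
  fixes d :: nat and \<theta> :: real
  assumes d: "1 \<le> d" and \<theta>: "0 < \<theta>" "\<theta> < 1"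
begin

lemma norm_on_T: "1 \<le> k \<Longrightarrow> norm_on (c00 k) (T_norm k d \<theta>)"
  by unfold_locales
    (auto simp: c00_zero c00_add c00_scale T_norm_triangle[OF d \<theta>] T_norm_scale[OF d \<theta>] T_norm_nonneg[OF d \<theta>])

text \<open>Replace the images of the unit vectors by nearby finitely supported vectors and extend
  linearly to \<open>\<Psi>\<close>. With summable errors \<open>\<Psi>\<close> stays close to the
  isomorphism, hence bounded and bounded below, contrary to
  \<open>not_bounded_below\<close>.\<close>

lemma not_isomorphic_less:
  assumes k: "1 \<le> k" and kK: "k < K" and growth: "1 < real d * \<theta>"
  shows "\<not> isomorphic (T_space K d \<theta>) (T_space k d \<theta>)"
proof
  assume iso: "isomorphic (T_space K d \<theta>) (T_space k d \<theta>)"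
  have K: "1 \<le> K" using k kK by simp
  interpret A: norm_on "c00 K" "T_norm K d \<theta>" by (rule norm_on_T[OF K])
  interpret B: norm_on "c00 k" "T_norm k d \<theta>" by (rule norm_on_T[OF k])
  show False
  proof (rule isomorphic_bounds[OF norm_on_T[OF K] norm_on_T[OF k] iso[unfolded T_space_def]])
    fix \<Phi> C assume C: "0 < C" and into: "\<And>A. A \<in> car A.E \<Longrightarrow> \<Phi> A \<in> car B.E"
      and add: "\<And>A B. A \<in> car A.E \<Longrightarrow> B \<in> car A.E \<Longrightarrow> \<Phi> (add A.E A B) = add B.E (\<Phi> A) (\<Phi> B)"
      and scale: "\<And>c A. A \<in> car A.E \<Longrightarrow> \<Phi> (scale A.E c A) = scale B.E c (\<Phi> A)"
      and upper: "\<And>A. A \<in> car A.E \<Longrightarrow> nrm B.E (\<Phi> A) \<le> C * nrm A.E A"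
      and lower: "\<And>A. A \<in> car A.E \<Longrightarrow> nrm A.E A \<le> C * nrm B.E (\<Phi> A)"
    \<comment> \<open>The total error is at most \<open>2 * \<epsilon> = 1 / (2 * C)\<close>, half
      of the lower bound \<open>1 / C\<close> of the isomorphism.\<close>
    define \<epsilon> where "\<epsilon> = 1 / (4 * C)"
    have \<epsilon>: "0 < \<epsilon>" using C by (simp add: \<epsilon>_def)
    \<comment> \<open>Lists are countable, so geometric weights along \<open>to_nat\<close> are
      summable over all leaves.\<close>
    define w where "w v = \<epsilon> * (1 / 2) ^ to_nat v" for v :: "nat list"
    have w: "0 < w v" for v using \<epsilon> by (simp add: w_def)
    have "\<exists>z\<in>c00 k. v \<in> ndseq K \<longrightarrow> B.dis (\<Phi> (A.emb (unit v))) (B.emb z) < w v" for v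
      using B.emb_dense[OF into[OF A.emb_in[OF unit_c00]] w, of v v] c00_zero by blast
    then obtain z where z: "\<And>v. z v \<in> c00 k"
        "\<And>v. v \<in> ndseq K \<Longrightarrow> B.dis (\<Phi> (A.emb (unit v))) (B.emb (z v)) < w v"
      by metis
    define \<Psi> where "\<Psi> x = (\<lambda>u. \<Sum>v\<in>supp x. x v * z v u)" for x :: "nat list \<Rightarrow> real"
    have \<Psi>: "\<Psi> x = (\<lambda>u. \<Sum>v\<in>S. x v * z v u)" if "finite S" "supp x \<subseteq> S" for x S
      unfolding \<Psi>_def using that by (intro ext sum.mono_neutral_left) (auto simp: supp_def)
    have \<Psi>_in: "\<Psi> x \<in> c00 k" for x
      unfolding \<Psi>_def by (intro c00_sum c00_scale z(1))
    have \<Psi>_add: "\<Psi> (\<lambda>v. x v + y v) = (\<lambda>u. \<Psi> x u + \<Psi> y u)" if "x \<in> c00 K" "y \<in> c00 K" for x y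
    proof -
      have "finite (supp x \<union> supp y)" using that by (simp add: c00_iff)
      then show ?thesis
        by (subst (1 2 3) \<Psi>[of "supp x \<union> supp y"])
          (auto simp: supp_def distrib_right sum.distrib)
    qed
    have \<Psi>_scale: "\<Psi> (\<lambda>v. c * x v) = (\<lambda>u. c * \<Psi> x u)" if "x \<in> c00 K" for c x
    proof -
      have "finite (supp x)" using that by (simp add: c00_iff)
      then show ?thesis
        by (subst (1 2) \<Psi>[of "supp x"]) (auto simp: supp_def sum_distrib_left mult.assoc)
    qed
    have approx: "B.dis (\<Phi> (A.emb (\<lambda>u. \<Sum>v\<in>S. a v * unit v u))) (B.emb (\<lambda>u. \<Sum>v\<in>S. a v * z v u)) \<le>
        (\<Sum>v\<in>S. \<bar>a v\<bar> * w v)" if "finite S" "S \<subseteq> ndseq K" for S a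
      using that
    proof (induction S)
      case empty
      have "B.dis (\<Phi> (A.emb (\<lambda>u. 0))) (B.emb (\<lambda>u. 0)) = 0"
      proof -
        have "A.emb (\<lambda>u. 0) = scale A.E 0 (A.emb (\<lambda>u. 0))" "B.emb (\<lambda>u. 0) = scale B.E 0 (B.emb (\<lambda>u. 0))"
          using A.emb_scale[OF c00_zero, of 0] B.emb_scale[OF c00_zero, of 0] by simp_all
        then show ?thesis
          using scale[OF A.emb_in[OF c00_zero], of 0]
            B.dis_scale[OF into[OF A.emb_in[OF c00_zero]] B.emb_in[OF c00_zero], of 0] by simp
      qed
      then show ?case by simp
    next
      case (insert v S)
      let ?x = "\<lambda>u. \<Sum>v\<in>S. a v * unit v u" and ?y = "\<lambda>u. \<Sum>v\<in>S. a v * z v u"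
      have v: "unit v \<in> c00 K" "v \<in> ndseq K" using insert.prems unit_c00 by auto
      have x: "?x \<in> c00 K" using insert.prems by (intro c00_sum c00_scale unit_c00) auto
      have y: "?y \<in> c00 k" by (intro c00_sum c00_scale z(1))
      note av = c00_scale[OF v(1), of "a v"] and az = c00_scale[OF z(1), of "a v" v]
      have "A.emb (\<lambda>u. \<Sum>v\<in>insert v S. a v * unit v u) = add A.E (scale A.E (a v) (A.emb (unit v))) (A.emb ?x)"
        using insert.hyps A.emb_add[OF av x] A.emb_scale[OF v(1)] by simp
      then have 1: "\<Phi> (A.emb (\<lambda>u. \<Sum>v\<in>insert v S. a v * unit v u)) =
          add B.E (scale B.E (a v) (\<Phi> (A.emb (unit v)))) (\<Phi> (A.emb ?x))"
        using add[OF A.scale_closed[OF A.emb_in[OF v(1)]] A.emb_in[OF x]] scale[OF A.emb_in[OF v(1)]] by simp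
      have 2: "B.emb (\<lambda>u. \<Sum>v\<in>insert v S. a v * z v u) = add B.E (scale B.E (a v) (B.emb (z v))) (B.emb ?y)"
        using insert.hyps B.emb_add[OF az y] B.emb_scale[OF z(1)] by simp
      note in_B = into[OF A.emb_in[OF v(1)]] into[OF A.emb_in[OF x]] B.emb_in[OF z(1), of v] B.emb_in[OF y]
      have "B.dis (\<Phi> (A.emb (\<lambda>u. \<Sum>v\<in>insert v S. a v * unit v u))) (B.emb (\<lambda>u. \<Sum>v\<in>insert v S. a v * z v u)) \<le>
          B.dis (scale B.E (a v) (\<Phi> (A.emb (unit v)))) (scale B.E (a v) (B.emb (z v))) +
          B.dis (\<Phi> (A.emb ?x)) (B.emb ?y)"
        unfolding 1 2 by (intro B.dis_add_le B.scale_closed in_B)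
      also have "\<dots> = \<bar>a v\<bar> * B.dis (\<Phi> (A.emb (unit v))) (B.emb (z v)) + B.dis (\<Phi> (A.emb ?x)) (B.emb ?y)"
        using B.dis_scale[OF in_B(1,3)] by simp
      also have "\<dots> \<le> \<bar>a v\<bar> * w v + (\<Sum>v\<in>S. \<bar>a v\<bar> * w v)"
        using z(2)[OF v(2)] insert by (intro add_mono mult_left_mono) auto
      finally show ?case using insert.hyps by simp
    qed
    have w_sum: "(\<Sum>v\<in>S. w v) \<le> 2 * \<epsilon>" if "finite S" for S
    proof -
      have "(\<Sum>v\<in>S. (1 / 2 :: real) ^ to_nat v) = (\<Sum>n\<in>to_nat ` S. (1 / 2) ^ n)"
        by (subst sum.reindex) (auto intro: inj_on_subset[OF inj_to_nat])
      also have "\<dots> \<le> (\<Sum>n. (1 / 2) ^ n)"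
        using that by (intro sum_le_suminf summable_geometric) auto
      also have "\<dots> = 2" by (subst suminf_geometric) auto
      finally show ?thesis using \<epsilon> by (simp add: w_def flip: sum_distrib_left)
    qed
    \<comment> \<open>Each coefficient of \<open>x\<close> is at most its norm, which turns the
      summed errors into an operator bound.\<close>
    have close: "B.dis (\<Phi> (A.emb x)) (B.emb (\<Psi> x)) \<le> 2 * \<epsilon> * T_norm K d \<theta> x" if x: "x \<in> c00 K" for x
    proof -
      have fin: "finite (supp x)" "supp x \<subseteq> ndseq K" using x by (auto simp: c00_iff)
      have "x = (\<lambda>u. \<Sum>v\<in>supp x. x v * unit v u)"
        using fin(1) by (auto simp: unit_def supp_def fun_eq_iff if_distrib sum.delta cong: if_cong)
      then have "B.dis (\<Phi> (A.emb x)) (B.emb (\<Psi> x)) \<le> (\<Sum>v\<in>supp x. \<bar>x v\<bar> * w v)"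
        using approx[OF fin, of x] unfolding \<Psi>_def by metis
      also have "\<dots> \<le> (\<Sum>v\<in>supp x. T_norm K d \<theta> x * w v)"
        using abs_le_T_norm[OF d \<theta> K x] w by (intro sum_mono mult_right_mono) (auto intro: less_imp_le)
      also have "\<dots> \<le> T_norm K d \<theta> x * (2 * \<epsilon>)"
        unfolding sum_distrib_left[symmetric]
        by (intro mult_left_mono w_sum fin T_norm_nonneg[OF d \<theta> K x])
      finally show ?thesis by (simp add: mult_ac)
    qed
    have \<Psi>_upper: "T_norm k d \<theta> (\<Psi> x) \<le> (C + 2 * \<epsilon>) * T_norm K d \<theta> x" if x: "x \<in> c00 K" for x
      using B.nrm_le_dis[OF B.emb_in[OF \<Psi>_in[of x]] into[OF A.emb_in[OF x]]] close[OF x] upper[OF A.emb_in[OF x]]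
        B.dis_commute[OF B.emb_in[OF \<Psi>_in[of x]] into[OF A.emb_in[OF x]]]
      by (simp add: A.nrm_emb[OF x] B.nrm_emb[OF \<Psi>_in] distrib_right)
    have \<Psi>_lower: "1 / (2 * C) * T_norm K d \<theta> x \<le> T_norm k d \<theta> (\<Psi> x)" if x: "x \<in> c00 K" for x
    proof -
      have "T_norm K d \<theta> x / C \<le> nrm B.E (\<Phi> (A.emb x))"
        using lower[OF A.emb_in[OF x]] C by (simp add: A.nrm_emb[OF x] field_simps)
      also have "\<dots> \<le> 2 * \<epsilon> * T_norm K d \<theta> x + T_norm k d \<theta> (\<Psi> x)"
        using B.nrm_le_dis[OF into[OF A.emb_in[OF x]] B.emb_in[OF \<Psi>_in[of x]]] close[OF x]
        by (simp add: B.nrm_emb[OF \<Psi>_in])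
      finally show ?thesis using C by (simp add: \<epsilon>_def field_simps)
    qed
    have "0 \<le> C + 2 * \<epsilon>" "1 < \<theta> * real d" "0 < 1 / (2 * C)"
      using C \<epsilon> growth by (auto simp: mult.commute)
    from not_bounded_below[OF d \<theta> k K \<Psi>_in \<Psi>_add \<Psi>_scale \<Psi>_upper this(1,2) kK this(3)]
    obtain x where "x \<in> c00 K" "T_norm k d \<theta> (\<Psi> x) < 1 / (2 * C) * T_norm K d \<theta> x"
      by blast
    then show False using \<Psi>_lower by force
  qed
qed

end

theorem theorem9p7:
  fixes d k1 k2 :: nat and \<theta> :: real
  assumes "d \<ge> 1" and "0 < \<theta>" and "\<theta> < 1" and "real d * \<theta> > 1"
    and "k1 \<ge> 1" and "k2 \<ge> 1" and "k1 \<noteq> k2"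
  shows "\<not> isomorphic (T_space k1 d \<theta>) (T_space k2 d \<theta>)"
proof
  assume iso: "isomorphic (T_space k1 d \<theta>) (T_space k2 d \<theta>)"
  have "isomorphic (T_space k2 d \<theta>) (T_space k1 d \<theta>)"
    using isomorphic_sym[OF norm_on_T norm_on_T] iso assms unfolding T_space_def by blast
  then show False
    using iso not_isomorphic_less assms by (metis nat_neq_iff)
qed

end
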